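(* Let $n\ge 1$, let $F:\mathbb{R}^n\times\mathbb{R}^n\to\mathbb{R}^n$ be a smooth function satisfying $F(\rho,\theta)=\mathscr{O}(|\rho||\theta|)$, let $0<\delta<1$, and let $f:\mathbb{R}\to\mathbb{R}^n$ be a $C^2$ function satisfying $$M_0=\sup_{x\in\mathbb{R}}\Big[\langle x\rangle^{\frac32(1+\delta)}\big(|f'(x)|+|f''(x)|\big)\Big]<+\infty .$$ Consider, for the unknown $u=u(t,x)\in\mathbb{R}^n$, the Cauchy problem $$u_{\xi\eta}=F\big(f'(\xi)+u_\xi,\,u_\eta\big),\qquad u|_{t=0}=u_0,\quad u_t|_{t=0}=u_1,$$ with smooth initial data $u_0,u_1:\mathbb{R}\to\mathbb{R}^n$. Then there exists a constant $\varepsilon_0>0$, depending on $\delta$ and $M_0$ (the function $F$ being fixed), such that for any $0<\varepsilon\le\varepsilon_0$, if $$\sum_{l=0}^{1}\Big(\|\langle x\rangle^{1+\delta}\partial_x^{l}\partial_x u_0\|_{L^2_x(\mathbb{R})}+\|\langle x\rangle^{1+\delta}\partial_x^{l}u_1\|_{L^2_x(\mathbb{R})}\Big)\le\varepsilon ,$$ then this Cauchy problem admits a unique global classical solution $u$. (In other words, in this sense the traveling wave solution $v=f(\xi)$ of the semilinear system $v_{\xi\eta}=F(v_\xi,v_\eta)$ is globally nonlinearly stable, with $v=u+f(\xi)$ denoting the perturbed solution.)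
   Context: Coordinates and derivatives: $(t,x)\in\mathbb{R}\times\mathbb{R}$ are Cartesian coordinates, $\xi=\frac{t+x}{2}$, $\eta=\frac{t-x}{2}$, $\partial_\xi=\partial_t+\partial_x$, $\partial_\eta=\partial_t-\partial_x$; subscripts denote these derivatives, so $u_\xi=u_t+u_x$, $u_\eta=u_t-u_x$, $u_{\xi\eta}=u_{tt}-u_{xx}$. The notation $f'(\xi)$ means $f'$ evaluated at $\xi=\frac{t+x}{2}$. Also $\langle x\rangle=(1+|x|^2)^{1/2}$. The notation $F(\rho,\theta)=\mathscr{O}(|\rho||\theta|)$ means: for every compact set $K\subset\mathbb{R}^n\times\mathbb{R}^n$ there is a constant $C_K$ with $|F(\rho,\theta)|\le C_K|\rho||\theta|$ for all $(\rho,\theta)\in K$. (In particular $F(\rho,0)=F(0,\theta)=0$, so $v=f(\xi)$ solves $v_{\xi\eta}=F(v_\xi,v_\eta)$.) A global classical solution is a $C^2$ function $u$ on $[0,\infty)\times\mathbb{R}$ satisfying the system and the initial conditions. *)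

theory Defs
  imports "HOL-Analysis.Analysis"
begin

(* Classical C^k regularity: all Frechet derivatives up to order k exist and are continuous
   (for a finite-dimensional domain, continuity of all directional derivatives f' x v is
   continuity of x |-> f' x).  Derivatives are taken within S, hence one-sided at boundary
   points of S; this is the usual notion whenever S is convex with nonempty interior, so that
   the derivative within S is unique.  Only UNIV and the closed half plane are used below. *)
primrec C_k_on ::
  "nat \<Rightarrow> 'a::euclidean_space set \<Rightarrow> ('a \<Rightarrow> 'b::real_normed_vector) \<Rightarrow> bool" where
  "C_k_on 0 S f = continuous_on S f"
| "C_k_on (Suc k) S f =
    (\<exists>f'. (\<forall>x\<in>S. (f has_derivative f' x) (at x within S)) \<and>
          (\<forall>v. C_k_on k S (\<lambda>x. f' x v)))"

definition smooth :: "('a::euclidean_space \<Rightarrow> 'b::real_normed_vector) \<Rightarrow> bool" where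
  "smooth f \<longleftrightarrow> (\<forall>k. C_k_on k UNIV f)"

definition bigO_product ::
  "((real^'n) \<times> (real^'n) \<Rightarrow> real^'n) \<Rightarrow> bool" where
  "bigO_product F \<longleftrightarrow>
    (\<forall>K. compact K \<longrightarrow>
      (\<exists>C. \<forall>(\<rho>, \<theta>)\<in>K. norm (F (\<rho>, \<theta>)) \<le> C * norm \<rho> * norm \<theta>))"

definition bracket :: "real \<Rightarrow> real" where
  "bracket x = (1 + \<bar>x\<bar>\<^sup>2) powr (1/2)"

definition Dx :: "(real \<Rightarrow> 'a::real_normed_vector) \<Rightarrow> real \<Rightarrow> 'a" where
  "Dx g = (\<lambda>x. vector_derivative g (at x))"

(* Lebesgue L^2 norm on the line, with value infinity if |g|^2 has infinite integral. *)
definition L2norm :: "(real \<Rightarrow> 'a::real_normed_vector) \<Rightarrow> ennreal" where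
  "L2norm g =
    (let I = (\<integral>\<^sup>+ x. ennreal ((norm (g x))\<^sup>2) \<partial>lborel)
     in if I = \<infinity> then \<infinity> else ennreal (sqrt (enn2real I)))"

(* Functions on [0,oo) x R are given as total functions of (t, x); the t-derivative is
   one-sided at t = 0, so that only values with t >= 0 matter. *)
definition d_t :: "(real \<times> real \<Rightarrow> 'a::real_normed_vector) \<Rightarrow> real \<times> real \<Rightarrow> 'a" where
  "d_t u = (\<lambda>(t, x). vector_derivative (\<lambda>s. u (s, x)) (at t within {0..}))"

definition d_x :: "(real \<times> real \<Rightarrow> 'a::real_normed_vector) \<Rightarrow> real \<times> real \<Rightarrow> 'a" where
  "d_x u = (\<lambda>(t, x). vector_derivative (\<lambda>y. u (t, y)) (at x))"

definition d_xi :: "(real \<times> real \<Rightarrow> 'a::real_normed_vector) \<Rightarrow> real \<times> real \<Rightarrow> 'a" where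
  "d_xi u = (\<lambda>p. d_t u p + d_x u p)"

definition d_eta :: "(real \<times> real \<Rightarrow> 'a::real_normed_vector) \<Rightarrow> real \<times> real \<Rightarrow> 'a" where
  "d_eta u = (\<lambda>p. d_t u p - d_x u p)"

definition global_classical_solution ::
  "((real^'n) \<times> (real^'n) \<Rightarrow> real^'n) \<Rightarrow> (real \<Rightarrow> real^'n) \<Rightarrow> (real \<Rightarrow> real^'n) \<Rightarrow>
   (real \<Rightarrow> real^'n) \<Rightarrow> (real \<times> real \<Rightarrow> real^'n) \<Rightarrow> bool" where
  "global_classical_solution F f u0 u1 u \<longleftrightarrow>
    C_k_on 2 ({0..} \<times> UNIV) u \<and>
    (\<forall>t\<ge>0. \<forall>x. d_eta (d_xi u) (t, x) =
       F (Dx f ((t + x) / 2) + d_xi u (t, x), d_eta u (t, x))) \<and>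
    (\<forall>x. u (0, x) = u0 x) \<and>
    (\<forall>x. d_t u (0, x) = u1 x)"

end

theory Submission
  imports Defs
begin

text \<open>
  The perturbed wave \<open>v = u + f(\<xi>)\<close> solves \<open>v\<^sub>\<xi>\<^sub>\<eta> = F(v\<^sub>\<xi>, v\<^sub>\<eta>)\<close>.  With
  \<open>\<rho> = v\<^sub>\<xi>\<close> and \<open>\<theta> = v\<^sub>\<eta>\<close> this is a pair of transport equations
  \<open>\<rho>\<^sub>\<eta> = F(\<rho>, \<theta>)\<close>, \<open>\<theta>\<^sub>\<xi> = F(\<rho>, \<theta>)\<close>, and integrating along characteristics turns it
  into a fixed-point equation \<open>V = V\<^sub>0 + wave_op (F \<circ> V)\<close> for \<open>V = (\<rho>, \<theta>)\<close>.  The datum of \<open>\<rho>\<close> is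
  large, since it contains \<open>f'\<close>, while the datum of \<open>\<theta>\<close> is small.  Both decay like
  \<open>\<langle>x\<rangle>\<close> to the power \<open>-(1 + \<delta>)\<close>: for the Cauchy data this is a Sobolev inequality on unit
  intervals (\<open>weighted_sobolev\<close>), and for \<open>f'\<close> it is part of the hypothesis.

  The null structure \<open>|F(\<rho>, \<theta>)| \<le> C |\<rho>| |\<theta>|\<close> makes both equations linear in the small
  unknown \<open>\<theta>\<close>.  Along the characteristic of \<open>\<theta>\<close> the coefficient \<open>\<rho>\<close> is an integrable function of
  the transversal variable, so Gronwall's inequality bounds the growth of \<open>\<theta>\<close> by a fixed
  factor, however large \<open>\<rho>\<close> is; along the characteristic of \<open>\<rho>\<close> the
  function \<open>\<theta>\<close> is integrable and small, so \<open>\<rho>\<close> changes by a small multiple of its weight.  The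
  Gronwall factor is built into the weights: with \<open>W\<close> a bounded primitive of the integrable weight
  \<open>w\<close>, the two bounds \<open>|\<rho>(t,x)| \<le> (M + 1) w(x+t)\<close> and
  \<open>|\<theta>(t,x)| \<le> \<epsilon> w(x-t) exp(\<Lambda> W(x+t))\<close> are preserved by every Picard step
  (\<open>picard_weighted_bound\<close>).  All iterates therefore stay in one compact ball, on which \<open>F\<close>
  and its derivative are Lipschitz continuous, and the iteration converges in norms weighted by
  \<open>exp(-\<kappa>t)\<close>, together with the \<open>x\<close>-derivatives of the iterates (locale \<open>picard_scheme\<close>).
  The smallness of the data enters through the invariance of the ball.

  It remains to pass between the fixed-point equation and the Cauchy problem.  A fixed point with a
  continuous \<open>x\<close>-derivative is continuously differentiable, because the transport equations supply the
  other derivative, and integrating \<open>(u\<^sub>\<xi> + u\<^sub>\<eta>)/2\<close> in time gives a \<open>C\<^sup>2\<close> solution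
  (\<open>fixpoint_classical_solution\<close>).  Conversely, the derivatives of every classical solution satisfy the
  fixed-point equation, by the symmetry of mixed second derivatives
  (\<open>classical_solution_fixpoint\<close>); two fixed points agree on every triangle of dependence, where both
  are bounded (\<open>wave_fixpoint_unique\<close>).
\<close>

section \<open>Integration along characteristics\<close>

abbreviation half_plane :: "(real \<times> real) set" where "half_plane \<equiv> {0..} \<times> UNIV"

text \<open>
  The solution with zero initial values of the transport equation \<open>u\<^sub>t - c u\<^sub>x = h\<close>.  The speed \<open>c = 1\<close> integrates in the
  direction \<open>\<eta>\<close>, \<open>c = -1\<close> in the direction \<open>\<xi>\<close>, and \<open>c = 0\<close> in \<open>t\<close>.
\<close>

definition duhamel :: "real \<Rightarrow> (real \<times> real \<Rightarrow> 'b::banach) \<Rightarrow> real \<times> real \<Rightarrow> 'b" where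
  "duhamel c h = (\<lambda>(t, x). integral {0..t} (\<lambda>s. h (s, x + c * (t - s))))"

lemma duhamel_integrand_continuous:
  assumes "continuous_on half_plane h"
  shows "continuous_on {0..t} (\<lambda>s. h (s, x + c * (t - s)))"
  by (rule continuous_on_compose2[OF assms]) (auto intro!: continuous_intros)

lemma duhamel_integrable:
  fixes h :: "real \<times> real \<Rightarrow> 'b::banach"
  assumes "continuous_on half_plane h"
  shows "(\<lambda>s. h (s, x + c * (t - s))) integrable_on {0..t}"
  by (rule integrable_continuous_real) (rule duhamel_integrand_continuous[OF assms])

text \<open>
  Rescaling moves the \<open>t\<close>-dependence from the domain of integration to the integrand, where theorems on
  parameter integrals over a fixed interval give joint continuity in \<open>(t, x)\<close>.
\<close>

lemma integral_eq_scaled_unit_interval: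
  fixes g :: "real \<Rightarrow> 'b::banach"
  assumes "0 \<le> t" "g integrable_on {0..t}"
  shows "integral {0..t} g = t *\<^sub>R integral {0..1} (\<lambda>r. g (t * r))"
proof (cases "t = 0")
  case False
  then have "(\<lambda>x. x / t) ` {0..t} = {0..1}"
    using assms by (subst image_divide_atLeastAtMost) auto
  then show ?thesis
    using integral_stretch_real[of t 0 t g] assms False by simp
qed auto

lemma duhamel_continuous:
  fixes h :: "real \<times> real \<Rightarrow> 'b::banach"
  assumes "continuous_on half_plane h"
  shows "continuous_on half_plane (duhamel c h)"
proof -
  have "continuous_on (half_plane \<times> cbox 0 1) (\<lambda>(z, r). h (fst z * r, snd z + c * (fst z - fst z * r)))"
    unfolding split_beta
    by (rule continuous_on_compose2[OF assms]) (auto intro!: continuous_intros)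
  then have "continuous_on half_plane (\<lambda>z. integral (cbox 0 (1::real))
      (\<lambda>r. h (fst z * r, snd z + c * (fst z - fst z * r))))"
    by (rule integral_continuous_on_param)
  then have "continuous_on half_plane (\<lambda>z. fst z *\<^sub>R integral (cbox 0 (1::real))
      (\<lambda>r. h (fst z * r, snd z + c * (fst z - fst z * r))))"
    by (intro continuous_intros)
  then show ?thesis
    by (rule continuous_on_eq)
      (auto simp: duhamel_def integral_eq_scaled_unit_interval duhamel_integrable[OF assms])
qed

lemma has_vector_derivative_shift:
  assumes "(f has_vector_derivative D) (at (x + a :: real))"
  shows "((\<lambda>x. f (x + a)) has_vector_derivative D) (at x)"
proof -
  have "((\<lambda>x. x + a) has_vector_derivative 1) (at x)"
    by (auto intro!: derivative_eq_intros)
  from vector_diff_chain_at[OF this assms] show ?thesis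
    by (simp add: o_def)
qed

lemma duhamel_derivative_x:
  fixes h hx :: "real \<times> real \<Rightarrow> 'b::banach"
  assumes h: "continuous_on half_plane h" and hx: "continuous_on half_plane hx"
    and d: "\<And>t x. 0 \<le> t \<Longrightarrow> ((\<lambda>x. h (t, x)) has_vector_derivative hx (t, x)) (at x)"
  shows "((\<lambda>x. duhamel c h (t, x)) has_vector_derivative duhamel c hx (t, x)) (at x)"
proof -
  have "((\<lambda>x. integral (cbox 0 t) (\<lambda>s. h (s, x + c * (t - s)))) has_vector_derivative
      integral (cbox 0 t) (\<lambda>s. hx (s, x + c * (t - s)))) (at x within UNIV)"
  proof (rule leibniz_rule_vector_derivative)
    show "((\<lambda>x. h (s, x + c * (t - s))) has_vector_derivative hx (s, x + c * (t - s)))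
        (at x within UNIV)" if "s \<in> cbox 0 t" for x s
      using has_vector_derivative_shift[OF d[of s "x + c * (t - s)"]] that by simp
    show "(\<lambda>s. h (s, x + c * (t - s))) integrable_on cbox 0 t" for x
      using duhamel_integrable[OF h] by simp
    show "continuous_on (UNIV \<times> cbox 0 t) (\<lambda>(x, s). hx (s, x + c * (t - s)))"
      unfolding split_beta
      by (rule continuous_on_compose2[OF hx]) (auto intro!: continuous_intros)
  qed auto
  then show ?thesis
    by (simp add: duhamel_def)
qed

lemma duhamel_derivative_char:
  fixes h :: "real \<times> real \<Rightarrow> 'b::banach"
  assumes h: "continuous_on half_plane h" and t: "0 \<le> t"
  shows "((\<lambda>t. duhamel c h (t, y - c * t)) has_vector_derivative h (t, y - c * t)) (at t within {0..})"
proof -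
  have "continuous_on {0..t+1} (\<lambda>s. h (s, y - c * s))"
    by (rule continuous_on_compose2[OF h]) (auto intro!: continuous_intros)
  then have "((\<lambda>t. integral {0..t} (\<lambda>s. h (s, y - c * s))) has_vector_derivative h (t, y - c * t))
      (at t within {0..t+1})"
    using t integral_has_vector_derivative by fastforce
  moreover have "at t within {0..t+1} = at t within {0..}"
    using t by (intro at_within_nhd[of _ "{..<t+1}"]) auto
  ultimately show ?thesis
    by (simp add: duhamel_def algebra_simps)
qed

text \<open>
  The majorant enters through a primitive \<open>\<Phi>\<close>, so that weights with an explicit antiderivative need no
  separate integration: this one estimate serves exponential weights in \<open>t\<close> as well as the
  Gronwall weights along characteristics.
\<close>

lemma norm_duhamel_le:
  fixes h :: "real \<times> real \<Rightarrow> 'b::banach"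
  assumes h: "continuous_on half_plane h" and t: "0 \<le> t"
    and \<Phi>: "\<And>s. s \<in> {0..t} \<Longrightarrow> (\<Phi> has_real_derivative \<phi> s) (at s)"
    and le: "\<And>s. s \<in> {0..t} \<Longrightarrow> norm (h (s, x + c * (t - s))) \<le> \<phi> s"
  shows "norm (duhamel c h (t, x)) \<le> \<Phi> t - \<Phi> 0"
proof -
  have \<phi>: "(\<phi> has_integral (\<Phi> t - \<Phi> 0)) {0..t}"
    using t \<Phi> by (intro fundamental_theorem_of_calculus)
      (auto simp: has_real_derivative_iff_has_vector_derivative intro: has_vector_derivative_at_within)
  have "norm (duhamel c h (t, x)) \<le> integral {0..t} \<phi>"
    unfolding duhamel_def prod.case
    by (rule integral_norm_bound_integral[OF duhamel_integrable[OF h]]) (use \<phi> le in auto)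
  then show ?thesis
    using \<phi> by (simp add: integral_unique)
qed

lemma duhamel_unique:
  fixes P :: "real \<times> real \<Rightarrow> 'b::banach"
  assumes h: "continuous_on half_plane h" and t: "0 \<le> t"
    and P: "\<And>t y. 0 \<le> t \<Longrightarrow>
      ((\<lambda>t. P (t, y - c * t)) has_vector_derivative h (t, y - c * t)) (at t within {0..})"
  shows "P (t, x) = P (0, x + c * t) + duhamel c h (t, x)"
proof -
  have "((\<lambda>s. h (s, (x + c * t) - c * s)) has_integral
      (P (t, (x + c * t) - c * t) - P (0, (x + c * t) - c * 0))) {0..t}"
    by (rule fundamental_theorem_of_calculus[OF t])
      (rule has_vector_derivative_within_subset[OF P], auto)
  then have "integral {0..t} (\<lambda>s. h (s, (x + c * t) - c * s)) = P (t, x) - P (0, x + c * t)"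
    by (simp add: integral_unique)
  then show ?thesis
    by (simp add: duhamel_def algebra_simps)
qed

lemma duhamel_diff:
  fixes h k :: "real \<times> real \<Rightarrow> 'b::banach"
  assumes "continuous_on half_plane h" "continuous_on half_plane k"
  shows "duhamel c h (t, x) - duhamel c k (t, x) = duhamel c (\<lambda>z. h z - k z) (t, x)"
  using integral_diff[OF duhamel_integrable[OF assms(1)] duhamel_integrable[OF assms(2)]]
  by (simp add: duhamel_def)

text \<open>
  On the closed half plane the \<open>t\<close>-derivative is one-sided at \<open>t = 0\<close>; the two partial derivatives combine
  into a total one because the \<open>x\<close>-derivative is continuous.
\<close>

lemma has_derivative_of_partials:
  fixes u :: "real \<times> real \<Rightarrow> 'b::real_normed_vector"
  assumes t: "0 \<le> t"
    and ut: "((\<lambda>s. u (s, x)) has_vector_derivative ut) (at t within {0..})"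
    and ux: "\<And>t x. 0 \<le> t \<Longrightarrow> ((\<lambda>x. u (t, x)) has_vector_derivative ux (t, x)) (at x)"
    and c: "continuous_on half_plane ux"
  shows "(u has_derivative (\<lambda>(\<tau>, \<xi>). \<tau> *\<^sub>R ut + \<xi> *\<^sub>R ux (t, x))) (at (t, x) within half_plane)"
proof -
  have "((\<lambda>(t, x). u (t, x)) has_derivative
      (\<lambda>(\<tau>, \<xi>). \<tau> *\<^sub>R ut + blinfun_scaleR_left (ux (t, x)) \<xi>)) (at (t, x) within {0..} \<times> UNIV)"
  proof (rule has_derivative_partialsI)
    show "((\<lambda>s. u (s, x)) has_derivative (\<lambda>\<tau>. \<tau> *\<^sub>R ut)) (at t within {0..})"
      using ut by (simp add: has_vector_derivative_def)
    show "((\<lambda>x. u (t, x)) has_derivative blinfun_scaleR_left (ux (t, x))) (at x within UNIV)"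
      if "t \<in> {0..}" for t x
      using ux[of t x] that by (auto simp: has_vector_derivative_def)
    have "continuous (at (t, x) within half_plane) ux"
      using c t by (auto simp: continuous_on_eq_continuous_within)
    then show "continuous (at (t, x) within half_plane) (\<lambda>(t, x). blinfun_scaleR_left (ux (t, x)))"
      unfolding split_beta prod.collapse
      by (rule bounded_linear.continuous[OF bounded_linear_blinfun_scaleR_left])
  qed auto
  then show ?thesis
    by simp
qed

text \<open>
  In the sheared coordinates \<open>(t, x + c t)\<close> the transport derivative becomes a partial derivative, so
  a transport equation supplies the \<open>t\<close>-derivative once the \<open>x\<close>-derivative is known to be continuous.
\<close>

lemma transport_has_derivative:
  fixes P :: "real \<times> real \<Rightarrow> 'b::real_normed_vector"
  assumes t: "0 \<le> t"
    and P: "((\<lambda>s. P (s, (x + c * t) - c * s)) has_vector_derivative h) (at t within {0..})"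
    and Px: "\<And>t x. 0 \<le> t \<Longrightarrow> ((\<lambda>x. P (t, x)) has_vector_derivative Px (t, x)) (at x)"
    and cont: "continuous_on half_plane Px"
  shows "(P has_derivative (\<lambda>(\<tau>, \<xi>). \<tau> *\<^sub>R (c *\<^sub>R Px (t, x) + h) + \<xi> *\<^sub>R Px (t, x))) (at (t, x) within half_plane)"
proof -
  define Q where "Q = (\<lambda>(t, y). P (t, y - c * t))"
  define Qy where "Qy = (\<lambda>(t, y). Px (t, y - c * t))"
  have "(Q has_derivative (\<lambda>(\<tau>, \<xi>). \<tau> *\<^sub>R h + \<xi> *\<^sub>R Qy (t, x + c * t))) (at (t, x + c * t) within half_plane)"
  proof (rule has_derivative_of_partials[OF t])
    show "((\<lambda>s. Q (s, x + c * t)) has_vector_derivative h) (at t within {0..})"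
      using P by (simp add: Q_def)
    show "((\<lambda>y. Q (t, y)) has_vector_derivative Qy (t, y)) (at y)" if "0 \<le> t" for t y
      using has_vector_derivative_shift[of "\<lambda>x. P (t, x)" _ y "- c * t"] Px[OF that, of "y - c * t"]
      by (simp add: Q_def Qy_def)
    show "continuous_on half_plane Qy"
      unfolding Qy_def split_beta
      by (rule continuous_on_compose2[OF cont]) (auto intro!: continuous_intros)
  qed
  moreover have sub: "(\<lambda>z. (fst z, snd z + c * fst z)) ` half_plane \<subseteq> half_plane"
    by auto
  ultimately have Q: "(Q has_derivative (\<lambda>(\<tau>, \<xi>). \<tau> *\<^sub>R h + \<xi> *\<^sub>R Qy (t, x + c * t)))
      (at ((\<lambda>z. (fst z, snd z + c * fst z)) (t, x)) within (\<lambda>z. (fst z, snd z + c * fst z)) ` half_plane)"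
    using has_derivative_subset[OF _ sub] by simp
  have shear: "((\<lambda>z. (fst z, snd z + c * fst z)) has_derivative (\<lambda>z. (fst z, snd z + c * fst z)))
      (at (t, x) within half_plane)"
    by (auto intro!: derivative_eq_intros)
  have "Q (fst z, snd z + c * fst z) = P z" for z
    by (simp add: Q_def)
  moreover have "(case (fst z, snd z + c * fst z) of (\<tau>, \<xi>) \<Rightarrow> \<tau> *\<^sub>R h + \<xi> *\<^sub>R Qy (t, x + c * t)) =
      (case z of (\<tau>, \<xi>) \<Rightarrow> \<tau> *\<^sub>R (c *\<^sub>R Px (t, x) + h) + \<xi> *\<^sub>R Px (t, x))" for z
    by (simp add: Qy_def split_beta scaleR_add_left scaleR_add_right mult.commute)
  ultimately show ?thesis
    using has_derivative_in_compose[OF shear Q] by simp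
qed

section \<open>Convergence of the Picard iteration\<close>

text \<open>
  The first component integrates in the direction \<open>\<eta>\<close> and yields \<open>v\<^sub>\<xi>\<close>; the second integrates in
  the direction \<open>\<xi>\<close> and yields \<open>v\<^sub>\<eta>\<close>.  Both have the same source term.
\<close>

definition wave_op :: "(real \<times> real \<Rightarrow> 'b::banach) \<Rightarrow> real \<times> real \<Rightarrow> 'b \<times> 'b" where
  "wave_op h = (\<lambda>z. (duhamel 1 h z, duhamel (-1) h z))"

lemma wave_op_continuous: "continuous_on half_plane h \<Longrightarrow> continuous_on half_plane (wave_op h)"
  unfolding wave_op_def by (intro continuous_intros duhamel_continuous)

lemma wave_op_derivative_x:
  assumes "continuous_on half_plane h" "continuous_on half_plane hx"
    and "\<And>t x. 0 \<le> t \<Longrightarrow> ((\<lambda>x. h (t, x)) has_vector_derivative hx (t, x)) (at x)"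
  shows "((\<lambda>x. wave_op h (t, x)) has_vector_derivative wave_op hx (t, x)) (at x)"
  unfolding wave_op_def
  by (intro has_vector_derivative_Pair duhamel_derivative_x assms)

lemma wave_op_diff:
  assumes "continuous_on half_plane h" "continuous_on half_plane k"
  shows "wave_op h z - wave_op k z = wave_op (\<lambda>z. h z - k z) z"
  using duhamel_diff[OF assms, of _ "fst z" "snd z"] by (simp add: wave_op_def)

text \<open>
  The triangle contains the backward characteristics of all its points, so estimates on it are
  self-contained.  It is needed because the derivatives of the data are not assumed to be bounded on the whole line.
\<close>

definition dependence_triangle :: "real \<Rightarrow> (real \<times> real) set" where
  "dependence_triangle R = {(t, x). 0 \<le> t \<and> t + \<bar>x\<bar> \<le> R}"

lemma dependence_triangle_subset: "dependence_triangle R \<subseteq> half_plane"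
  by (auto simp: dependence_triangle_def)

lemma compact_dependence_triangle: "compact (dependence_triangle R)"
proof (rule compact_eq_bounded_closed[THEN iffD2], intro conjI)
  have "dependence_triangle R \<subseteq> {0..\<bar>R\<bar>} \<times> {-\<bar>R\<bar>..\<bar>R\<bar>}"
    by (auto simp: dependence_triangle_def)
  then show "bounded (dependence_triangle R)"
    using bounded_Times[OF bounded_closed_interval bounded_closed_interval] bounded_subset by blast
  have "dependence_triangle R = {z. 0 \<le> fst z} \<inter> {z. fst z + \<bar>snd z\<bar> \<le> R}"
    by (auto simp: dependence_triangle_def)
  also have "closed \<dots>"
    by (intro closed_Int closed_Collect_le continuous_intros)
  finally show "closed (dependence_triangle R)" .
qed

text \<open>
  Integrating \<open>exp(\<kappa>s)\<close> gains a factor \<open>1/\<kappa>\<close>.  In the norm weighted by \<open>exp(-\<kappa>t)\<close> the operator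
  is therefore a contraction after composition with any Lipschitz map, once \<open>\<kappa>\<close> is large.
\<close>

lemma norm_wave_op_le:
  fixes h :: "real \<times> real \<Rightarrow> 'b::banach"
  assumes h: "continuous_on half_plane h" and z: "(t, x) \<in> dependence_triangle R" and "0 < \<kappa>"
    and le: "\<And>s y. (s, y) \<in> dependence_triangle R \<Longrightarrow> norm (h (s, y)) \<le> m * exp (\<kappa> * s)"
  shows "norm (wave_op h (t, x)) \<le> 2 * m / \<kappa> * exp (\<kappa> * t)"
proof -
  have t: "0 \<le> t" using z by (simp add: dependence_triangle_def)
  have "norm (h (0, x)) \<le> m * exp (\<kappa> * 0)"
    using z by (intro le) (auto simp: dependence_triangle_def)
  then have m: "0 \<le> m"
    using norm_ge_zero[of "h (0, x)"] by (simp only: mult_zero_right exp_zero mult_1_right)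
  have "norm (duhamel c h (t, x)) \<le> m / \<kappa> * exp (\<kappa> * t)" if "\<bar>c\<bar> = 1" for c
  proof -
    have "norm (duhamel c h (t, x)) \<le> m / \<kappa> * exp (\<kappa> * t) - m / \<kappa> * exp (\<kappa> * 0)"
    proof (rule norm_duhamel_le[OF h t])
      fix s assume s: "s \<in> {0..t}"
      show "((\<lambda>s. m / \<kappa> * exp (\<kappa> * s)) has_real_derivative m * exp (\<kappa> * s)) (at s)"
        using \<open>0 < \<kappa>\<close> by (auto intro!: derivative_eq_intros)
      have "\<bar>x + c * (t - s)\<bar> \<le> \<bar>x\<bar> + (t - s)"
        using that s abs_triangle_ineq[of x "c * (t - s)"] by (simp add: abs_mult)
      then show "norm (h (s, x + c * (t - s))) \<le> m * exp (\<kappa> * s)"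
        using z s by (intro le) (auto simp: dependence_triangle_def)
    qed
    also have "\<dots> \<le> m / \<kappa> * exp (\<kappa> * t)"
      using m \<open>0 < \<kappa>\<close> by simp
    finally show ?thesis .
  qed
  from this[of 1] this[of "-1"]
  have "norm (wave_op h (t, x)) \<le> m / \<kappa> * exp (\<kappa> * t) + m / \<kappa> * exp (\<kappa> * t)"
    using norm_Pair_le[of "duhamel 1 h (t, x)" "duhamel (-1) h (t, x)"]
    unfolding wave_op_def by linarith
  then show ?thesis
    by (simp add: mult.assoc)
qed

lemma uniform_limit_lim_geometric:
  fixes f :: "nat \<Rightarrow> 'a \<Rightarrow> 'b::banach"
  assumes "\<And>n z. z \<in> S \<Longrightarrow> norm (f (Suc n) z - f n z) \<le> A / 2 ^ n"
  shows "uniform_limit S f (\<lambda>z. lim (\<lambda>n. f n z)) sequentially"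
proof -
  have "summable (\<lambda>n. A / 2 ^ n)"
    using summable_mult[OF summable_geometric[of "1/2::real"], of A] by (simp add: power_divide)
  then have "uniform_limit S (\<lambda>n z. \<Sum>i<n. f (Suc i) z - f i z)
      (\<lambda>z. suminf (\<lambda>i. f (Suc i) z - f i z)) sequentially"
    using assms by (intro Weierstrass_m_test) auto
  then have "uniform_limit S (\<lambda>n z. f 0 z + (\<Sum>i<n. f (Suc i) z - f i z))
      (\<lambda>z. f 0 z + suminf (\<lambda>i. f (Suc i) z - f i z)) sequentially"
    by (intro uniform_limit_intros)
  then have u: "uniform_limit S f (\<lambda>z. f 0 z + suminf (\<lambda>i. f (Suc i) z - f i z)) sequentially"
    by (simp add: sum_lessThan_telescope[of "\<lambda>n. f n _"])
  have "lim (\<lambda>n. f n z) = f 0 z + suminf (\<lambda>i. f (Suc i) z - f i z)" if "z \<in> S" for z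
    using tendsto_uniform_limitI[OF u that] by (rule limI)
  then show ?thesis
    using u uniform_limit_cong'[of S f f "\<lambda>z. lim (\<lambda>n. f n z)"] by simp
qed

lemma continuous_on_half_plane_if_triangles:
  assumes "\<And>R. continuous_on (dependence_triangle R) f"
  shows "continuous_on half_plane f"
  unfolding continuous_on_eq_continuous_within
proof
  fix z :: "real \<times> real" assume z: "z \<in> half_plane"
  define R where "R = \<bar>fst z\<bar> + \<bar>snd z\<bar> + 1"
  define U where "U = {z :: real \<times> real. \<bar>fst z\<bar> + \<bar>snd z\<bar> < R}"
  have "open U"
    unfolding U_def by (intro open_Collect_less continuous_intros)
  moreover have "z \<in> U"
    by (simp add: U_def R_def)
  moreover have "dependence_triangle R \<inter> U - {z} = half_plane \<inter> U - {z}"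
    by (auto simp: dependence_triangle_def U_def)
  ultimately have "at z within dependence_triangle R = at z within half_plane"
    by (intro at_within_nhd[of _ U]) auto
  moreover have "z \<in> dependence_triangle R"
    using z by (auto simp: dependence_triangle_def R_def)
  ultimately show "continuous (at z within half_plane) f"
    using assms[of R] unfolding continuous_on_eq_continuous_within by metis
qed

text \<open>
  Starting from zero, all weighted bounds hold trivially for the first iterate.
\<close>

primrec picard :: "('b \<times> 'b \<Rightarrow> 'b::banach) \<Rightarrow> (real \<times> real \<Rightarrow> 'b \<times> 'b) \<Rightarrow> nat \<Rightarrow> real \<times> real \<Rightarrow> 'b \<times> 'b"
  where
  "picard F V0 0 = (\<lambda>z. 0)"
| "picard F V0 (Suc n) = (\<lambda>z. V0 z + wave_op (\<lambda>z. F (picard F V0 n z)) z)"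

text \<open>
  The formal \<open>x\<close>-derivative of the Picard iteration; \<open>F'\<close> is the derivative of \<open>F\<close>, \<open>V\<close> the sequence of iterates.
\<close>

primrec picard_x :: "('b \<times> 'b \<Rightarrow> 'b \<times> 'b \<Rightarrow> 'b::banach) \<Rightarrow> (nat \<Rightarrow> real \<times> real \<Rightarrow> 'b \<times> 'b) \<Rightarrow>
    (real \<times> real \<Rightarrow> 'b \<times> 'b) \<Rightarrow> nat \<Rightarrow> real \<times> real \<Rightarrow> 'b \<times> 'b"
  where
  "picard_x F' V Z0 0 = (\<lambda>z. 0)"
| "picard_x F' V Z0 (Suc n) = (\<lambda>z. Z0 z + wave_op (\<lambda>z. F' (V n z) (picard_x F' V Z0 n z)) z)"

text \<open>
  The last assumption confines all iterates to a compact convex set, so that Lipschitz constants of \<open>F\<close>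
  and \<open>F'\<close> are required only there.  For small data it is supplied by weighted bounds of the iterates.
\<close>

locale picard_scheme =
  fixes F :: "'b::euclidean_space \<times> 'b \<Rightarrow> 'b" and F' :: "'b \<times> 'b \<Rightarrow> 'b \<times> 'b \<Rightarrow> 'b"
    and V0 Z0 :: "real \<times> real \<Rightarrow> 'b \<times> 'b" and K :: "('b \<times> 'b) set" and L :: real
  assumes F: "\<And>v. (F has_derivative F' v) (at v)"
    and F'_continuous: "continuous_on UNIV (\<lambda>(v, z). F' v z)"
    and K: "convex K" "compact K" and L: "0 < L"
    and F'_bound: "\<And>v z. v \<in> K \<Longrightarrow> norm (F' v z) \<le> L * norm z"
    and F'_lipschitz: "\<And>v w z. v \<in> K \<Longrightarrow> w \<in> K \<Longrightarrow> norm (F' v z - F' w z) \<le> L * norm (v - w) * norm z"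
    and V0_continuous: "continuous_on half_plane V0" and Z0_continuous: "continuous_on half_plane Z0"
    and V0_derivative: "\<And>t x. 0 \<le> t \<Longrightarrow> ((\<lambda>x. V0 (t, x)) has_vector_derivative Z0 (t, x)) (at x)"
    and invariant: "\<And>n z. z \<in> half_plane \<Longrightarrow> picard F V0 n z \<in> K"
begin

abbreviation "V \<equiv> picard F V0"
abbreviation "Z \<equiv> picard_x F' V Z0"
definition "V_lim z = lim (\<lambda>n. V n z)"
definition "Z_lim z = lim (\<lambda>n. Z n z)"

lemma F_continuous:
  assumes "continuous_on half_plane v"
  shows "continuous_on half_plane (\<lambda>z. F (v z))"
proof -
  have "continuous_on UNIV F"
    by (rule has_derivative_continuous_on) (rule F)
  from continuous_on_compose2[OF this assms] show ?thesis
    by simp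
qed

lemma F'_continuous':
  "continuous_on half_plane v \<Longrightarrow> continuous_on half_plane z \<Longrightarrow> continuous_on half_plane (\<lambda>p. F' (v p) (z p))"
  using continuous_on_compose2[OF F'_continuous continuous_on_Pair, of half_plane v z] by simp

lemma F_lipschitz:
  assumes "v \<in> K" "w \<in> K"
  shows "norm (F v - F w) \<le> L * norm (v - w)"
proof (rule differentiable_bound[OF K(1) _ _ assms])
  show "(F has_derivative F' x) (at x within K)" for x
    by (rule has_derivative_at_withinI[OF F])
  show "onorm (F' x) \<le> L" if "x \<in> K" for x
    by (rule onorm_le[OF F'_bound[OF that]])
qed

lemma V_continuous: "continuous_on half_plane (V n)"
  by (induction n)
    (simp_all add: continuous_on_add V0_continuous wave_op_continuous F_continuous)

lemma Z_continuous: "continuous_on half_plane (Z n)"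
  by (induction n)
    (simp_all add: continuous_on_add Z0_continuous wave_op_continuous F'_continuous' V_continuous)

lemma V_derivative: "0 \<le> t \<Longrightarrow> ((\<lambda>x. V n (t, x)) has_vector_derivative Z n (t, x)) (at x)"
proof (induction n arbitrary: t x)
  case (Suc n)
  have "((\<lambda>x. F (V n (t, x))) has_vector_derivative F' (V n (t, x)) (Z n (t, x))) (at x)"
    if "0 \<le> t" for t x
    using vector_derivative_diff_chain_within[OF Suc.IH[OF that, of x] has_derivative_at_withinI[OF F]]
    by (simp add: o_def)
  then show ?case
    using Suc.prems by (simp add: has_vector_derivative_add V0_derivative wave_op_derivative_x
        F_continuous F'_continuous' V_continuous Z_continuous)
qed simp

text \<open>
  With \<open>\<kappa> = 4L\<close> each step halves the weighted distance of consecutive iterates; the first distance is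
  finite because the iterates stay in a bounded set.
\<close>

lemma V_step:
  obtains D where "0 \<le> D" "\<And>n t x. 0 \<le> t \<Longrightarrow> norm (V (Suc n) (t, x) - V n (t, x)) \<le> D / 2 ^ n * exp (4 * L * t)"
proof -
  obtain B where B: "\<And>v. v \<in> K \<Longrightarrow> norm v \<le> B"
    using compact_imp_bounded[OF K(2)] unfolding bounded_iff by blast
  then have B0: "0 \<le> B"
    using order_trans[OF norm_ge_zero B[OF invariant[of "(0, 0)" 0]]] by simp
  have "norm (V (Suc n) (t, x) - V n (t, x)) \<le> 2 * B / 2 ^ n * exp (4 * L * t)" if "0 \<le> t" for n t x
    using that
  proof (induction n arbitrary: t x)
    case 0
    have "norm (V 1 (t, x)) \<le> B"
      using 0 by (intro B invariant) auto
    also have "B \<le> 2 * B * exp (4 * L * t)"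
      using B0 0 L mult_mono[of B "2 * B" 1 "exp (4 * L * t)"] by simp
    finally show ?case by simp
  next
    case (Suc n)
    have "V (Suc (Suc n)) (t, x) - V (Suc n) (t, x) =
        wave_op (\<lambda>z. F (V (Suc n) z) - F (V n z)) (t, x)"
      by (subst wave_op_diff[symmetric, OF F_continuous F_continuous]) (rule V_continuous, rule V_continuous, simp)
    also have "norm \<dots> \<le> 2 * (L * (2 * B / 2 ^ n)) / (4 * L) * exp (4 * L * t)"
    proof (rule norm_wave_op_le[where R = "t + \<bar>x\<bar>"])
      fix s y assume "(s, y) \<in> dependence_triangle (t + \<bar>x\<bar>)"
      then have s: "0 \<le> s" by (simp add: dependence_triangle_def)
      have "norm (F (V (Suc n) (s, y)) - F (V n (s, y))) \<le> L * norm (V (Suc n) (s, y) - V n (s, y))"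
        using s by (intro F_lipschitz invariant) auto
      also have "\<dots> \<le> L * (2 * B / 2 ^ n * exp (4 * L * s))"
        using L Suc.IH[OF s] by (intro mult_left_mono) auto
      finally show "norm (F (V (Suc n) (s, y)) - F (V n (s, y))) \<le> L * (2 * B / 2 ^ n) * exp (4 * L * s)"
        by (simp add: mult.assoc)
    qed (use Suc.prems L in \<open>simp_all add: dependence_triangle_def continuous_on_diff F_continuous V_continuous
        del: picard.simps(2)\<close>)
    also have "\<dots> = 2 * B / 2 ^ Suc n * exp (4 * L * t)"
      using L by simp
    finally show ?case .
  qed
  then show thesis
    using B0 by (intro that[of "2 * B"]) auto
qed

lemma Z_bound:
  obtains E where "0 \<le> E" "\<And>n t x. (t, x) \<in> dependence_triangle R \<Longrightarrow> norm (Z n (t, x)) \<le> E * exp (4 * L * t)"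
proof -
  have "bounded (Z0 ` dependence_triangle R)"
    using compact_continuous_image[OF continuous_on_subset[OF Z0_continuous dependence_triangle_subset] compact_dependence_triangle]
    by (rule compact_imp_bounded)
  then obtain B where B: "0 < B" "\<And>z. z \<in> dependence_triangle R \<Longrightarrow> norm (Z0 z) \<le> B"
    unfolding bounded_pos by blast
  have "norm (Z n (t, x)) \<le> 2 * B * exp (4 * L * t)" if "(t, x) \<in> dependence_triangle R" for n t x
    using that
  proof (induction n arbitrary: t x)
    case 0
    then show ?case using B by simp
  next
    case (Suc n)
    have t: "0 \<le> t" using Suc.prems by (simp add: dependence_triangle_def)
    have "norm (wave_op (\<lambda>z. F' (V n z) (Z n z)) (t, x)) \<le> 2 * (L * (2 * B)) / (4 * L) * exp (4 * L * t)"
    proof (rule norm_wave_op_le[OF _ Suc.prems])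
      fix s y assume sy: "(s, y) \<in> dependence_triangle R"
      have "norm (F' (V n (s, y)) (Z n (s, y))) \<le> L * norm (Z n (s, y))"
        using sy dependence_triangle_subset by (intro F'_bound invariant) auto
      also have "\<dots> \<le> L * (2 * B * exp (4 * L * s))"
        using L Suc.IH[OF sy] by (intro mult_left_mono) auto
      finally show "norm (F' (V n (s, y)) (Z n (s, y))) \<le> L * (2 * B) * exp (4 * L * s)"
        by (simp add: mult.assoc)
    qed (use L in \<open>simp_all add: F'_continuous' V_continuous Z_continuous\<close>)
    moreover have "norm (Z0 (t, x)) \<le> B * exp (4 * L * t)"
      using B(2)[OF Suc.prems] mult_left_mono[of 1 "exp (4 * L * t)" B] B(1) L t
      by (fastforce intro: order_trans)
    ultimately show ?case
      using norm_triangle_ineq[of "Z0 (t, x)" "wave_op (\<lambda>z. F' (V n z) (Z n z)) (t, x)"] L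
      by simp
  qed
  then show thesis
    using B by (intro that[of "2 * B"]) auto
qed

text \<open>
  The difference of consecutive derivatives has two sources: the linear part contracts, and the change
  of the coefficient is at most the distance of the iterates times the size of the derivative.  The second
  source grows like \<open>exp(4Lt)\<close> squared, which is why the rate in the weight is \<open>8L\<close>.
\<close>

lemma Z_step:
  obtains G where "0 \<le> G"
    "\<And>n t x. (t, x) \<in> dependence_triangle R \<Longrightarrow> norm (Z (Suc n) (t, x) - Z n (t, x)) \<le> G / 2 ^ n * exp (8 * L * t)"
proof -
  obtain D where D: "0 \<le> D"
      "\<And>n t x. 0 \<le> t \<Longrightarrow> norm (V (Suc n) (t, x) - V n (t, x)) \<le> D / 2 ^ n * exp (4 * L * t)"
    using V_step by blast
  obtain E where E: "0 \<le> E" "\<And>n t x. (t, x) \<in> dependence_triangle R \<Longrightarrow> norm (Z n (t, x)) \<le> E * exp (4 * L * t)"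
    using Z_bound[of R] by blast
  define G where "G = D * E + E"
  have G: "0 \<le> G" "D * E \<le> G" "E \<le> G"
    using D E by (auto simp: G_def)
  have "norm (Z (Suc n) (t, x) - Z n (t, x)) \<le> G / 2 ^ n * exp (8 * L * t)"
    if "(t, x) \<in> dependence_triangle R" for n t x
    using that
  proof (induction n arbitrary: t x)
    case 0
    have "norm (Z 1 (t, x)) \<le> E * exp (4 * L * t)"
      by (rule E(2)[OF 0])
    also have "\<dots> \<le> G * exp (8 * L * t)"
      using 0 G E L by (intro mult_mono) (auto simp: dependence_triangle_def)
    finally show ?case by simp
  next
    case (Suc n)
    have "Z (Suc (Suc n)) (t, x) - Z (Suc n) (t, x) =
        wave_op (\<lambda>z. F' (V (Suc n) z) (Z (Suc n) z) - F' (V n z) (Z n z)) (t, x)"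
      by (subst wave_op_diff[symmetric, OF F'_continuous' F'_continuous'])
        (rule V_continuous Z_continuous | simp)+
    also have "norm \<dots> \<le> 2 * (2 * L * G / 2 ^ n) / (8 * L) * exp (8 * L * t)"
    proof (rule norm_wave_op_le[OF _ Suc.prems])
      fix s y assume sy: "(s, y) \<in> dependence_triangle R"
      then have sH: "(s, y) \<in> half_plane" and s: "0 \<le> s" by (auto simp: dependence_triangle_def)
      let ?v = "V (Suc n) (s, y)" and ?w = "V n (s, y)"
      let ?a = "Z (Suc n) (s, y)" and ?b = "Z n (s, y)"
      interpret F': bounded_linear "F' ?v"
        using F has_derivative_bounded_linear by blast
      have "F' ?v ?a - F' ?w ?b = F' ?v (?a - ?b) + (F' ?v ?b - F' ?w ?b)"
        unfolding F'.diff by simp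
      then have "norm (F' ?v ?a - F' ?w ?b) \<le> norm (F' ?v (?a - ?b)) + norm (F' ?v ?b - F' ?w ?b)"
        using norm_triangle_ineq by metis
      also have "\<dots> \<le> L * norm (?a - ?b) + L * norm (?v - ?w) * norm ?b"
        by (intro add_mono F'_bound F'_lipschitz invariant sH)
      also have "L * norm (?a - ?b) \<le> L * (G / 2 ^ n * exp (8 * L * s))"
        using L Suc.IH[OF sy] by (intro mult_left_mono) auto
      also have "L * norm (?v - ?w) * norm ?b \<le> L * (D / 2 ^ n * exp (4 * L * s)) * (E * exp (4 * L * s))"
        using L D E s sy by (intro mult_mono mult_left_mono) auto
      also have "\<dots> = L * (D * E / 2 ^ n * exp (8 * L * s))"
        using exp_add[of "4 * L * s" "4 * L * s"] by (simp add: mult_ac)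
      also have "\<dots> \<le> L * (G / 2 ^ n * exp (8 * L * s))"
        using L G by (intro mult_left_mono mult_right_mono divide_right_mono) auto
      finally show "norm (F' ?v ?a - F' ?w ?b) \<le> 2 * L * G / 2 ^ n * exp (8 * L * s)"
        by (simp add: mult_ac)
    qed (use L in \<open>simp_all add: continuous_on_diff F'_continuous' V_continuous Z_continuous
        del: picard.simps(2) picard_x.simps(2)\<close>)
    also have "\<dots> = G / 2 ^ Suc n * exp (8 * L * t)"
      using L by simp
    finally show ?case .
  qed
  then show thesis
    using G by (intro that[of G]) auto
qed

lemma V_uniform_limit: "uniform_limit (dependence_triangle R) V V_lim sequentially"
proof -
  obtain D where D: "0 \<le> D"
      "\<And>n t x. 0 \<le> t \<Longrightarrow> norm (V (Suc n) (t, x) - V n (t, x)) \<le> D / 2 ^ n * exp (4 * L * t)"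
    using V_step by blast
  have "norm (V (Suc n) z - V n z) \<le> D * exp (4 * L * R) / 2 ^ n" if "z \<in> dependence_triangle R" for n z
  proof -
    obtain t x where z: "z = (t, x)" "0 \<le> t" "t \<le> R"
      using \<open>z \<in> dependence_triangle R\<close> by (auto simp: dependence_triangle_def)
    then have "norm (V (Suc n) z - V n z) \<le> D / 2 ^ n * exp (4 * L * t)"
      using D by simp
    also have "\<dots> \<le> D / 2 ^ n * exp (4 * L * R)"
      using z D L by (intro mult_left_mono) auto
    finally show ?thesis by simp
  qed
  then show ?thesis
    unfolding V_lim_def by (rule uniform_limit_lim_geometric)
qed

lemma Z_uniform_limit: "uniform_limit (dependence_triangle R) Z Z_lim sequentially"
proof -
  obtain D where D: "0 \<le> D"
      "\<And>n t x. (t, x) \<in> dependence_triangle R \<Longrightarrow> norm (Z (Suc n) (t, x) - Z n (t, x)) \<le> D / 2 ^ n * exp (8 * L * t)"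
    using Z_step[of R] by blast
  have "norm (Z (Suc n) z - Z n z) \<le> D * exp (8 * L * R) / 2 ^ n" if "z \<in> dependence_triangle R" for n z
  proof -
    obtain t x where z: "z = (t, x)" "0 \<le> t" "t \<le> R"
      using \<open>z \<in> dependence_triangle R\<close> by (auto simp: dependence_triangle_def)
    then have "norm (Z (Suc n) z - Z n z) \<le> D / 2 ^ n * exp (8 * L * t)"
      using D that by simp
    also have "\<dots> \<le> D / 2 ^ n * exp (8 * L * R)"
      using z D L by (intro mult_left_mono) auto
    finally show ?thesis by simp
  qed
  then show ?thesis
    unfolding Z_lim_def by (rule uniform_limit_lim_geometric)
qed

lemma V_lim_continuous: "continuous_on half_plane V_lim"
proof (rule continuous_on_half_plane_if_triangles, rule uniform_limit_theorem[OF _ V_uniform_limit])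
  show "\<forall>\<^sub>F n in sequentially. continuous_on (dependence_triangle R) (V n)" for R
    by (intro always_eventually allI continuous_on_subset[OF V_continuous dependence_triangle_subset])
qed simp

lemma Z_lim_continuous: "continuous_on half_plane Z_lim"
proof (rule continuous_on_half_plane_if_triangles, rule uniform_limit_theorem[OF _ Z_uniform_limit])
  show "\<forall>\<^sub>F n in sequentially. continuous_on (dependence_triangle R) (Z n)" for R
    by (intro always_eventually allI continuous_on_subset[OF Z_continuous dependence_triangle_subset])
qed simp

lemma V_tendsto: "z \<in> half_plane \<Longrightarrow> (\<lambda>n. V n z) \<longlonglongrightarrow> V_lim z"
  by (rule tendsto_uniform_limitI[OF V_uniform_limit[of "fst z + \<bar>snd z\<bar>"]])
    (auto simp: dependence_triangle_def)

lemma V_lim_in: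
  assumes "z \<in> half_plane"
  shows "V_lim z \<in> K"
  by (rule closed_sequentially[OF compact_imp_closed[OF K(2)] _ V_tendsto[OF assms]])
    (rule invariant[OF assms])

lemma V_lim_derivative:
  assumes "0 \<le> t"
  shows "((\<lambda>x. V_lim (t, x)) has_vector_derivative Z_lim (t, x)) (at x)"
proof -
  define S where "S = {x - 1<..<x + 1}"
  have S: "(t, y) \<in> dependence_triangle (t + \<bar>x\<bar> + 1)" if "y \<in> S" for y
    using that assms by (auto simp: S_def dependence_triangle_def)
  have "\<exists>g. \<forall>y\<in>S. (\<lambda>n. V n (t, y)) \<longlonglongrightarrow> g y \<and>
      (g has_derivative (\<lambda>\<xi>. \<xi> *\<^sub>R Z_lim (t, y))) (at y within S)"
  proof (rule has_derivative_sequence)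
    show "((\<lambda>x. V n (t, x)) has_derivative (\<lambda>\<xi>. \<xi> *\<^sub>R Z n (t, y))) (at y within S)" for n y
      by (rule has_derivative_at_withinI)
        (rule V_derivative[OF assms, unfolded has_vector_derivative_def])
    show "\<forall>\<^sub>F n in sequentially. \<forall>y\<in>S. \<forall>\<xi>. norm (\<xi> *\<^sub>R Z n (t, y) - \<xi> *\<^sub>R Z_lim (t, y)) \<le> e * norm \<xi>"
      if "0 < e" for e :: real
      using uniform_limitD[OF Z_uniform_limit that, of "t + \<bar>x\<bar> + 1"]
    proof eventually_elim
      case (elim n)
      show ?case
      proof (intro ballI allI)
        fix y \<xi> :: real assume "y \<in> S"
        then have "norm (Z n (t, y) - Z_lim (t, y)) \<le> e"
          using elim S[of y] by (simp add: dist_norm less_imp_le)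
        then have "norm (\<xi> *\<^sub>R (Z n (t, y) - Z_lim (t, y))) \<le> \<bar>\<xi>\<bar> * e"
          by (simp add: mult_left_mono)
        then show "norm (\<xi> *\<^sub>R Z n (t, y) - \<xi> *\<^sub>R Z_lim (t, y)) \<le> e * norm \<xi>"
          by (simp add: scaleR_diff_right mult.commute)
      qed
    qed
    show "(\<lambda>n. V n (t, x)) \<longlonglongrightarrow> V_lim (t, x)"
      using assms by (intro V_tendsto) auto
  qed (auto simp: S_def)
  then obtain g where g: "\<And>y. y \<in> S \<Longrightarrow> (\<lambda>n. V n (t, y)) \<longlonglongrightarrow> g y"
    "\<And>y. y \<in> S \<Longrightarrow> (g has_derivative (\<lambda>\<xi>. \<xi> *\<^sub>R Z_lim (t, y))) (at y within S)"
    by blast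
  have "g y = V_lim (t, y)" if "y \<in> S" for y
    using LIMSEQ_unique[OF g(1)[OF that] V_tendsto] assms by auto
  moreover have "x \<in> S" "open S"
    by (auto simp: S_def)
  ultimately have "((\<lambda>y. V_lim (t, y)) has_derivative (\<lambda>\<xi>. \<xi> *\<^sub>R Z_lim (t, x))) (at x within S)"
    by (intro has_derivative_transform[OF _ _ g(2)]) simp_all
  then show ?thesis
    unfolding has_vector_derivative_def at_within_open[OF \<open>x \<in> S\<close> \<open>open S\<close>] .
qed

lemma V_lim_fixpoint:
  assumes "z \<in> half_plane"
  shows "V_lim z = V0 z + wave_op (\<lambda>z. F (V_lim z)) z"
proof -
  obtain t x where z: "z = (t, x)" "0 \<le> t"
    using assms by auto
  define R where "R = t + \<bar>x\<bar>"
  have tri: "(t, x) \<in> dependence_triangle R"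
    using z by (auto simp: dependence_triangle_def R_def)
  have "(\<lambda>n. wave_op (\<lambda>z. F (V n z)) z) \<longlonglongrightarrow> wave_op (\<lambda>z. F (V_lim z)) z"
  proof (rule tendstoI)
    fix e :: real assume "0 < e"
    define \<eta> where "\<eta> = e / (4 * L * exp t)"
    have \<eta>: "0 < \<eta>" using \<open>0 < e\<close> L by (simp add: \<eta>_def)
    show "\<forall>\<^sub>F n in sequentially. dist (wave_op (\<lambda>z. F (V n z)) z) (wave_op (\<lambda>z. F (V_lim z)) z) < e"
      using uniform_limitD[OF V_uniform_limit \<eta>, of R]
    proof eventually_elim
      case (elim n)
      have "wave_op (\<lambda>z. F (V n z)) z - wave_op (\<lambda>z. F (V_lim z)) z =
          wave_op (\<lambda>z. F (V n z) - F (V_lim z)) z"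
        by (intro wave_op_diff F_continuous V_continuous V_lim_continuous)
      also have "norm \<dots> \<le> 2 * (L * \<eta>) / 1 * exp (1 * t)"
        unfolding z
      proof (rule norm_wave_op_le[OF _ tri])
        fix s y assume sy: "(s, y) \<in> dependence_triangle R"
        then have "norm (F (V n (s, y)) - F (V_lim (s, y))) \<le> L * norm (V n (s, y) - V_lim (s, y))"
          using dependence_triangle_subset by (intro F_lipschitz invariant V_lim_in) auto
        also have "\<dots> \<le> L * \<eta>"
          using elim[rule_format, OF sy] L by (intro mult_left_mono) (auto simp: dist_norm)
        also have "\<dots> \<le> L * \<eta> * exp (1 * s)"
          using mult_left_mono[of 1 "exp s" "L * \<eta>"] L \<eta> sy by (simp add: dependence_triangle_def)
        finally show "norm (F (V n (s, y)) - F (V_lim (s, y))) \<le> L * \<eta> * exp (1 * s)" .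
      qed (simp_all add: continuous_on_diff F_continuous V_continuous V_lim_continuous)
      also have "\<dots> < e"
        using L \<open>0 < e\<close> by (simp add: \<eta>_def)
      finally show ?case
        by (simp add: dist_norm)
    qed
  qed
  then have "(\<lambda>n. V (Suc n) z) \<longlonglongrightarrow> V0 z + wave_op (\<lambda>z. F (V_lim z)) z"
    by (simp add: tendsto_add)
  then show ?thesis
    using LIMSEQ_unique[OF LIMSEQ_Suc[OF V_tendsto[OF assms]]] by simp
qed

end

section \<open>Invariance of weighted bounds\<close>

text \<open>
  The function \<open>\<langle>y\<rangle>\<close> to the power \<open>-(1+\<delta>)\<close> has no convenient primitive.  It is dominated by the derivative of
  the logistic function evaluated at \<open>\<delta> arsinh y\<close>, because \<open>exp(arsinh |y|) \<le> 2\<langle>y\<rangle>\<close>; the primitive of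
  this majorant is explicit and bounded.
\<close>

lemma integrable_weight:
  fixes \<delta> :: real
  assumes \<delta>: "0 < \<delta>" "\<delta> < 1"
  obtains W w :: "real \<Rightarrow> real" where
    "\<And>y. (W has_real_derivative w y) (at y)" "\<And>y. 0 \<le> W y" "\<And>y. W y \<le> 6 / \<delta>"
    "\<And>y. bracket y powr - (1 + \<delta>) \<le> w y" "\<And>y. w y \<le> 3"
proof
  \<comment> \<open>The constant 6 comes from \<open>e\<^sup>b + 2 + e\<^sup>-\<^sup>b \<le> 6 \<langle>y\<rangle>\<^sup>\<delta>\<close> with \<open>b = \<delta> arsinh y\<close>.\<close>
  define E where "E y = exp (- (\<delta> * arsinh y))" for y :: real
  define W where "W y = 6 / \<delta> * inverse (1 + E y)" for y
  define w where "w y = 6 * (E y / (1 + E y)\<^sup>2) / sqrt (y\<^sup>2 + 1)" for y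
  have E: "0 < E y" for y
    by (simp add: E_def)
  show "(W has_real_derivative w y) (at y)" for y
  proof -
    have "(E has_real_derivative - (\<delta> / sqrt (y\<^sup>2 + 1)) * E y) (at y)"
      unfolding E_def by (auto intro!: derivative_eq_intros)
    moreover have "1 + E y \<noteq> 0"
      using E[of y] by linarith
    ultimately have "(W has_real_derivative
        6 / \<delta> * - (inverse (1 + E y) * (- (\<delta> / sqrt (y\<^sup>2 + 1)) * E y) * inverse (1 + E y))) (at y)"
      unfolding W_def by (auto intro!: derivative_eq_intros)
    moreover have "6 / \<delta> * - (i * (- (\<delta> / r) * e) * i) = 6 * (e * i\<^sup>2) / r" for i r e :: real
      using \<delta> by (simp add: power2_eq_square field_simps)
    ultimately show ?thesis
      by (simp only: w_def divide_inverse[of "E y" "(1 + E y)\<^sup>2"] power_inverse)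
  qed
  show "0 \<le> W y" for y
    using E[of y] \<delta> by (simp add: W_def)
  have "inverse (1 + E y) \<le> 1" for y
    using E[of y] by (simp add: field_simps)
  then show "W y \<le> 6 / \<delta>" for y
    using mult_left_mono[of "inverse (1 + E y)" 1 "6 / \<delta>"] \<delta> by (simp add: W_def)
  have frac: "E y / (1 + E y)\<^sup>2 = 1 / (E y + 2 + inverse (E y))" for y
    using E[of y] by (simp add: field_simps power2_eq_square)
  have br: "bracket y = sqrt (y\<^sup>2 + 1)" "1 \<le> bracket y" for y
    by (auto simp: bracket_def powr_half_sqrt add.commute)
  show "w y \<le> 3" for y
  proof -
    have "E y / (1 + E y)\<^sup>2 \<le> 1 / 2"
      unfolding frac using E[of y] by (intro divide_left_mono) (auto simp: add_pos_pos add_nonneg_pos)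
    moreover have "0 \<le> E y / (1 + E y)\<^sup>2"
      using E[of y] by simp
    ultimately have "6 * (E y / (1 + E y)\<^sup>2) / bracket y \<le> 3 / 1"
      using br(2)[of y] by (intro frac_le) auto
    then show ?thesis
      by (simp add: w_def br)
  qed
  show "bracket y powr - (1 + \<delta>) \<le> w y" for y
  proof -
    have up: "exp (\<delta> * arsinh x) \<le> 2 * bracket x powr \<delta>" for x :: real
    proof -
      have "exp (arsinh x) = x + sqrt (x\<^sup>2 + 1)"
        using arsinh_real_aux[of x] by (simp add: arsinh_real_def)
      also have "\<dots> \<le> 2 * bracket x"
        using real_le_rsqrt[of x "x\<^sup>2 + 1"] by (simp add: br)
      finally have "exp (arsinh x) powr \<delta> \<le> (2 * bracket x) powr \<delta>"
        using \<delta> by (intro powr_mono2) auto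
      also have "\<dots> = 2 powr \<delta> * bracket x powr \<delta>"
        using br(2)[of x] by (simp add: powr_mult)
      also have "\<dots> \<le> 2 powr 1 * bracket x powr \<delta>"
        using \<delta> by (intro mult_right_mono powr_mono) auto
      finally show ?thesis
        by (simp add: exp_powr_real mult.commute)
    qed
    have "E y \<le> 2 * bracket y powr \<delta>"
      using up[of "- y"] by (simp add: E_def bracket_def)
    moreover have "inverse (E y) \<le> 2 * bracket y powr \<delta>"
      using up[of y] by (simp add: E_def exp_minus)
    moreover have "1 \<le> bracket y powr \<delta>"
      using br(2)[of y] \<delta> by (simp add: ge_one_powr_ge_zero)
    ultimately have "E y + 2 + inverse (E y) \<le> 6 * bracket y powr \<delta>"
      by linarith
    moreover have "0 < E y + 2 + inverse (E y)"
      using E[of y] by (simp add: add_pos_pos)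
    ultimately have "1 / (6 * bracket y powr \<delta>) \<le> E y / (1 + E y)\<^sup>2"
      unfolding frac by (intro divide_left_mono mult_pos_pos) (use br(2)[of y] in auto)
    then have "6 * (1 / (6 * bracket y powr \<delta>)) / bracket y \<le> w y"
      unfolding w_def br(1)[symmetric] using br(2)[of y] by (intro divide_right_mono mult_left_mono) auto
    moreover have "bracket y powr - (1 + \<delta>) = inverse (bracket y powr 1 * bracket y powr \<delta>)"
      by (simp only: powr_minus powr_add)
    moreover have "\<dots> = 6 * (1 / (6 * bracket y powr \<delta>)) / bracket y"
      using br(2)[of y] by (simp add: field_simps)
    ultimately show ?thesis
      by linarith
  qed
qed

definition wave_data :: "(real \<Rightarrow> 'b) \<Rightarrow> (real \<Rightarrow> 'b) \<Rightarrow> real \<times> real \<Rightarrow> 'b \<times> 'b" where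
  "wave_data a b = (\<lambda>(t, x). (a (x + t), b (x - t)))"

lemma wave_data_continuous:
  fixes a b :: "real \<Rightarrow> 'b::real_normed_vector"
  assumes "continuous_on UNIV a" "continuous_on UNIV b"
  shows "continuous_on half_plane (wave_data a b)"
proof -
  have "continuous_on half_plane (\<lambda>z. a (snd z + fst z))" "continuous_on half_plane (\<lambda>z. b (snd z - fst z))"
    by (rule continuous_on_compose2[OF assms(1)] continuous_on_compose2[OF assms(2)],
        intro continuous_intros, simp)+
  then show ?thesis
    unfolding wave_data_def split_beta by (rule continuous_on_Pair)
qed

lemma picard_continuous:
  assumes "continuous_on UNIV F" "continuous_on half_plane V0"
  shows "continuous_on half_plane (picard F V0 n)"
proof (induction n)
  case (Suc n)
  then have "continuous_on half_plane (\<lambda>z. F (picard F V0 n z))"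
    by (intro continuous_on_compose2[OF assms(1)]) auto
  then show ?case
    by (simp add: continuous_on_add wave_op_continuous assms)
qed simp

text \<open>
  The exponential in the second bound is the exact Gronwall factor: along the characteristic
  \<open>s \<mapsto> (s, x - t + s)\<close> of the second unknown, the derivative of \<open>\<epsilon> w(x-t) exp(\<Lambda> W(x - t + 2s))\<close>
  equals the bound of the source term, so the bound reproduces itself without loss and for
  arbitrary \<open>M\<close>.  For the first unknown the integral of the source is at most
  \<open>C (M+1) w(x+t) \<epsilon> exp(\<Lambda>B) B/2\<close>, and this is where \<open>\<epsilon>\<close> has to be small.
\<close>

lemma picard_weighted_bound:
  fixes F :: "'b::euclidean_space \<times> 'b \<Rightarrow> 'b"
  assumes F: "continuous_on UNIV F"
    and ab: "continuous_on UNIV a" "continuous_on UNIV b"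
    and W: "\<And>y. (W has_real_derivative w y) (at y)" "\<And>y. 0 \<le> W y" "\<And>y. W y \<le> B"
    and w: "\<And>y. 0 \<le> w y" "\<And>y. w y \<le> k"
    and a: "\<And>y. norm (a y) \<le> M * w y" and b: "\<And>y. norm (b y) \<le> \<epsilon> * w y"
    and C: "0 \<le> C" "\<And>\<rho> \<theta>. norm \<rho> \<le> R \<Longrightarrow> norm \<theta> \<le> R \<Longrightarrow> norm (F (\<rho>, \<theta>)) \<le> C * norm \<rho> * norm \<theta>"
    and M: "0 \<le> M" "(M + 1) * k \<le> R"
    and \<Lambda>: "2 * \<Lambda> = C * (M + 1)"
    and \<epsilon>: "0 \<le> \<epsilon>" "\<epsilon> * k * exp (\<Lambda> * B) \<le> R" "C * (M + 1) * (\<epsilon> * exp (\<Lambda> * B)) * B \<le> 2"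
    and t: "0 \<le> t"
  shows "norm (fst (picard F (wave_data a b) n (t, x))) \<le> (M + 1) * w (x + t)"
    and "norm (snd (picard F (wave_data a b) n (t, x))) \<le> \<epsilon> * w (x - t) * exp (\<Lambda> * W (x + t))"
    and "norm (picard F (wave_data a b) n (t, x)) \<le> 2 * R"
proof -
  have \<Lambda>0: "0 \<le> \<Lambda>" using \<Lambda> C M by (smt (verit) mult_nonneg_nonneg)
  have small: "(M + 1) * w y \<le> R" "\<epsilon> * w y * exp (\<Lambda> * W z) \<le> R" for y z
  proof -
    show "(M + 1) * w y \<le> R"
      using mult_left_mono[OF w(2), of "M + 1" y] M by linarith
    have "\<epsilon> * w y * exp (\<Lambda> * W z) \<le> \<epsilon> * k * exp (\<Lambda> * B)"
      using \<epsilon> w W \<Lambda>0 order_trans[OF w(1) w(2)] by (intro mult_mono mult_left_mono) (auto intro: mult_left_mono)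
    then show "\<epsilon> * w y * exp (\<Lambda> * W z) \<le> R"
      using \<epsilon> by linarith
  qed
  have "norm (fst (picard F (wave_data a b) n (t, x))) \<le> (M + 1) * w (x + t) \<and>
    norm (snd (picard F (wave_data a b) n (t, x))) \<le> \<epsilon> * w (x - t) * exp (\<Lambda> * W (x + t))"
    using t
  proof (induction n arbitrary: t x)
    case 0
    then show ?case
      using M w \<epsilon> by simp
  next
    case (Suc n)
    let ?V = "picard F (wave_data a b) n"
    have cont: "continuous_on half_plane (\<lambda>z. F (?V z))"
      by (rule continuous_on_compose2[OF F picard_continuous[OF F wave_data_continuous[OF ab]]]) auto
    \<comment> \<open>The null structure of the nonlinearity turns the two bounds into a bound of the product.\<close>
    have Fle: "norm (F (?V (s, y))) \<le> C * ((M + 1) * w (y + s)) * (\<epsilon> * w (y - s) * exp (\<Lambda> * W (y + s)))"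
      if "0 \<le> s" for s y
    proof -
      have V: "norm (fst (?V (s, y))) \<le> (M + 1) * w (y + s)"
        "norm (snd (?V (s, y))) \<le> \<epsilon> * w (y - s) * exp (\<Lambda> * W (y + s))"
        using Suc.IH[OF that] by auto
      have "norm (F (fst (?V (s, y)), snd (?V (s, y)))) \<le> C * norm (fst (?V (s, y))) * norm (snd (?V (s, y)))"
        using V small order_trans by (intro C(2)) blast+
      also have "\<dots> \<le> C * ((M + 1) * w (y + s)) * (\<epsilon> * w (y - s) * exp (\<Lambda> * W (y + s)))"
        using V C M w by (intro mult_mono mult_left_mono) auto
      finally show ?thesis by simp
    qed
    have "norm (duhamel (-1) (\<lambda>z. F (?V z)) (t, x)) \<le>
        \<epsilon> * w (x - t) * exp (\<Lambda> * W (x - t + 2 * t)) - \<epsilon> * w (x - t) * exp (\<Lambda> * W (x - t + 2 * 0))"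
    proof (rule norm_duhamel_le[OF cont Suc.prems])
      fix s assume s: "s \<in> {0..t}"
      show "((\<lambda>s. \<epsilon> * w (x - t) * exp (\<Lambda> * W (x - t + 2 * s))) has_real_derivative
          C * ((M + 1) * w (x - t + 2 * s)) * (\<epsilon> * w (x - t) * exp (\<Lambda> * W (x - t + 2 * s)))) (at s)"
        unfolding mult.assoc[symmetric] \<Lambda>[symmetric]
        by (auto intro!: derivative_eq_intros DERIV_chain2[OF W(1)])
      show "norm (F (?V (s, x + - 1 * (t - s)))) \<le>
          C * ((M + 1) * w (x - t + 2 * s)) * (\<epsilon> * w (x - t) * exp (\<Lambda> * W (x - t + 2 * s)))"
        using Fle[of s "x - t + s"] s by (simp add: algebra_simps)
    qed
    moreover have "1 \<le> exp (\<Lambda> * W (x - t))"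
      using \<Lambda>0 W by simp
    then have "\<epsilon> * w (x - t) * 1 \<le> \<epsilon> * w (x - t) * exp (\<Lambda> * W (x - t))"
      using \<epsilon> w by (intro mult_left_mono) auto
    ultimately have snd: "norm (b (x - t) + duhamel (-1) (\<lambda>z. F (?V z)) (t, x)) \<le>
        \<epsilon> * w (x - t) * exp (\<Lambda> * W (x + t))"
      using b[of "x - t"] norm_triangle_ineq[of "b (x - t)" "duhamel (-1) (\<lambda>z. F (?V z)) (t, x)"]
      by (simp add: add.commute[of x t])
    \<comment> \<open>On the other characteristic the weight of the first unknown is constant and that of the second is integrated.\<close>
    define A where "A = C * ((M + 1) * w (x + t)) * (\<epsilon> * exp (\<Lambda> * B))"
    have A: "0 \<le> A"
      using C M w \<epsilon> by (simp add: A_def)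
    have "norm (duhamel 1 (\<lambda>z. F (?V z)) (t, x)) \<le>
        - (A * W (x + t - 2 * t) / 2) - - (A * W (x + t - 2 * 0) / 2)"
    proof (rule norm_duhamel_le[OF cont Suc.prems])
      fix s assume s: "s \<in> {0..t}"
      show "((\<lambda>s. - (A * W (x + t - 2 * s) / 2)) has_real_derivative A * w (x + t - 2 * s)) (at s)"
        by (auto intro!: derivative_eq_intros DERIV_chain2[OF W(1)])
      have "norm (F (?V (s, x + 1 * (t - s)))) \<le>
          C * ((M + 1) * w (x + t)) * (\<epsilon> * w (x + t - 2 * s) * exp (\<Lambda> * W (x + t)))"
        using Fle[of s "x + t - s"] s by (simp add: algebra_simps)
      also have "\<dots> \<le> C * ((M + 1) * w (x + t)) * (\<epsilon> * w (x + t - 2 * s) * exp (\<Lambda> * B))"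
        using C M w \<epsilon> \<Lambda>0 W by (intro mult_left_mono) (auto intro: mult_left_mono)
      also have "\<dots> = A * w (x + t - 2 * s)"
        by (simp add: A_def)
      finally show "norm (F (?V (s, x + 1 * (t - s)))) \<le> A * w (x + t - 2 * s)" .
    qed
    also have "\<dots> \<le> A * B / 2"
      using mult_left_mono[OF W(3)[of "x + t"] A] mult_nonneg_nonneg[OF A W(2)[of "x - t"]] by simp
    also have "\<dots> = (C * (M + 1) * (\<epsilon> * exp (\<Lambda> * B)) * B) * (w (x + t) / 2)"
      by (simp add: A_def)
    also have "\<dots> \<le> 2 * (w (x + t) / 2)"
      using \<epsilon> w by (intro mult_right_mono) auto
    finally have "norm (a (x + t) + duhamel 1 (\<lambda>z. F (?V z)) (t, x)) \<le> M * w (x + t) + w (x + t)"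
      using a[of "x + t"] norm_triangle_ineq[of "a (x + t)" "duhamel 1 (\<lambda>z. F (?V z)) (t, x)"] by simp
    with snd show ?case
      by (simp add: wave_data_def wave_op_def algebra_simps)
  qed
  then show bounds: "norm (fst (picard F (wave_data a b) n (t, x))) \<le> (M + 1) * w (x + t)"
    "norm (snd (picard F (wave_data a b) n (t, x))) \<le> \<epsilon> * w (x - t) * exp (\<Lambda> * W (x + t))"
    by auto
  have "norm (picard F (wave_data a b) n (t, x)) \<le>
      norm (fst (picard F (wave_data a b) n (t, x))) + norm (snd (picard F (wave_data a b) n (t, x)))"
    using norm_Pair_le[of "fst (picard F (wave_data a b) n (t, x))" "snd (picard F (wave_data a b) n (t, x))"]
    by simp
  then show "norm (picard F (wave_data a b) n (t, x)) \<le> 2 * R"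
    using bounds small(1)[of "x + t"] small(2)[of "x - t" "x + t"] by linarith
qed

section \<open>Uniqueness of fixed points\<close>

text \<open>
  On a triangle of dependence both solutions are bounded, so \<open>F\<close> is Lipschitz continuous on their values.  The maximum of
  \<open>exp(-4Lt) |V - V'|\<close> over the triangle is then at most half of itself.
\<close>

lemma wave_fixpoint_unique:
  fixes F :: "'b::euclidean_space \<times> 'b \<Rightarrow> 'b"
  assumes F: "continuous_on UNIV F"
    and lip: "\<And>B. \<exists>L>0. \<forall>v\<in>cball 0 B. \<forall>w\<in>cball 0 B. norm (F v - F w) \<le> L * norm (v - w)"
    and V: "continuous_on half_plane V" "\<And>z. z \<in> half_plane \<Longrightarrow> V z = V0 z + wave_op (\<lambda>z. F (V z)) z"
    and V': "continuous_on half_plane V'" "\<And>z. z \<in> half_plane \<Longrightarrow> V' z = V0 z + wave_op (\<lambda>z. F (V' z)) z"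
    and z: "z \<in> half_plane"
  shows "V z = V' z"
proof -
  define R where "R = fst z + \<bar>snd z\<bar>"
  have zR: "z \<in> dependence_triangle R"
    using z by (auto simp: dependence_triangle_def R_def)
  have "compact (V ` dependence_triangle R \<union> V' ` dependence_triangle R)"
    by (intro compact_Un compact_continuous_image compact_dependence_triangle continuous_on_subset[OF _ dependence_triangle_subset] V V')
  then have "bounded (V ` dependence_triangle R \<union> V' ` dependence_triangle R)"
    by (rule compact_imp_bounded)
  then obtain B where B: "\<And>v. v \<in> V ` dependence_triangle R \<union> V' ` dependence_triangle R \<Longrightarrow> norm v \<le> B"
    unfolding bounded_iff by blast
  obtain L where L: "0 < L" "\<And>v w. v \<in> cball 0 B \<Longrightarrow> w \<in> cball 0 B \<Longrightarrow> norm (F v - F w) \<le> L * norm (v - w)"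
    using lip[of B] by blast
  define g where "g z = exp (- (4 * L * fst z)) * norm (V z - V' z)" for z
  have "continuous_on (dependence_triangle R) g"
    unfolding g_def
    by (intro continuous_intros continuous_on_subset[OF _ dependence_triangle_subset] V V')
  then obtain p where p: "p \<in> dependence_triangle R" "\<And>q. q \<in> dependence_triangle R \<Longrightarrow> g q \<le> g p"
    using continuous_attains_sup[OF compact_dependence_triangle] zR by blast
  have FV: "continuous_on half_plane (\<lambda>z. F (V z))" "continuous_on half_plane (\<lambda>z. F (V' z))"
    using continuous_on_compose2[OF F V(1)] continuous_on_compose2[OF F V'(1)] by auto
  have le: "norm (V q - V' q) \<le> g p * exp (4 * L * fst q)" if "q \<in> dependence_triangle R" for q
    using mult_right_mono[OF p(2)[OF that], of "exp (4 * L * fst q)"]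
    by (simp add: g_def exp_minus field_simps)
  obtain t x where tx: "p = (t, x)" by (cases p)
  have "p \<in> half_plane"
    using p(1) dependence_triangle_subset by blast
  then have "V p - V' p = wave_op (\<lambda>z. F (V z) - F (V' z)) p"
    using V(2)[of p] V'(2)[of p] wave_op_diff[OF FV, of p] by (metis add_diff_cancel_left)
  also have "norm \<dots> \<le> 2 * (L * g p) / (4 * L) * exp (4 * L * t)"
    unfolding tx
  proof (rule norm_wave_op_le)
    fix s y assume sy: "(s, y) \<in> dependence_triangle R"
    have "norm (F (V (s, y)) - F (V' (s, y))) \<le> L * norm (V (s, y) - V' (s, y))"
      using B sy by (intro L) auto
    also have "\<dots> \<le> L * (g p * exp (4 * L * s))"
      using le[OF sy] L by (intro mult_left_mono) auto
    finally show "norm (F (V (s, y)) - F (V' (s, y))) \<le> L * g (t, x) * exp (4 * L * s)"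
      by (simp add: tx mult.assoc)
  qed (use FV p L tx in \<open>auto intro: continuous_on_diff\<close>)
  finally have "g p \<le> g p / 2"
    using L by (simp add: g_def tx exp_minus field_simps)
  then have "g p * exp (4 * L * fst z) \<le> 0"
    using mult_right_mono[of "g p" 0 "exp (4 * L * fst z)"] by simp
  then have "norm (V z - V' z) \<le> 0"
    using le[OF zR] by linarith
  then show ?thesis
    by simp
qed

section \<open>Bounds for the derivative of a twice differentiable map\<close>

text \<open>
  A linear map on a finite-dimensional space is controlled by its values on a basis, which turns
  continuity in each fixed direction into a uniform operator bound.
\<close>

lemma linear_family_bounded:
  fixes A :: "'a::topological_space \<Rightarrow> 'c::euclidean_space \<Rightarrow> 'b::real_normed_vector"
  assumes lin: "\<And>v. bounded_linear (A v)" and cont: "\<And>b. continuous_on S (\<lambda>v. A v b)" and "compact S"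
  obtains L where "0 < L" "\<And>v y. v \<in> S \<Longrightarrow> norm (A v y) \<le> L * norm y"
proof -
  have "\<exists>M. \<forall>v\<in>S. norm (A v b) \<le> M" for b
    using compact_imp_bounded[OF compact_continuous_image[OF cont \<open>compact S\<close>], of b]
    by (auto simp: bounded_iff)
  then obtain M where M: "\<And>b v. v \<in> S \<Longrightarrow> norm (A v b) \<le> M b"
    by metis
  define L where "L = 1 + (\<Sum>b\<in>Basis. \<bar>M b\<bar>)"
  have "norm (A v y) \<le> L * norm y" if "v \<in> S" for v y
  proof -
    interpret bounded_linear "A v" by (rule lin)
    have "A v y = A v (\<Sum>b\<in>Basis. (y \<bullet> b) *\<^sub>R b)"
      by (simp add: euclidean_representation)
    also have "\<dots> = (\<Sum>b\<in>Basis. (y \<bullet> b) *\<^sub>R A v b)"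
      by (simp add: sum scaleR)
    finally have "norm (A v y) \<le> (\<Sum>b\<in>Basis. \<bar>M b\<bar> * norm y)"
      using M[OF that] Basis_le_norm[of _ y]
      by (auto intro!: sum_norm_le simp: mult.commute abs_le_iff[of _ "M _"] intro!: mult_mono order_trans[OF M[OF that] abs_ge_self])
    also have "\<dots> \<le> L * norm y"
      by (simp add: L_def sum_distrib_right[symmetric] distrib_right)
    finally show ?thesis .
  qed
  moreover have "0 < L"
    by (simp add: L_def add_pos_nonneg sum_nonneg)
  ultimately show thesis
    using that by blast
qed

lemma linear_family_continuous:
  fixes A :: "'a::topological_space \<Rightarrow> 'c::euclidean_space \<Rightarrow> 'b::real_normed_vector"
  assumes lin: "\<And>v. bounded_linear (A v)" and cont: "\<And>b. continuous_on UNIV (\<lambda>v. A v b)"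
  shows "continuous_on UNIV (\<lambda>(v, y). A v y)"
proof -
  have expand: "A v y = (\<Sum>b\<in>Basis. (y \<bullet> b) *\<^sub>R A v b)" for v y
  proof -
    interpret bounded_linear "A v" by (rule lin)
    have "A v y = A v (\<Sum>b\<in>Basis. (y \<bullet> b) *\<^sub>R b)"
      by (simp add: euclidean_representation)
    then show ?thesis
      by (simp add: sum scaleR)
  qed
  have "continuous_on UNIV (\<lambda>z. A (fst z) b)" for b
    by (rule continuous_on_compose2[OF cont continuous_on_fst[OF continuous_on_id]]) simp
  then have "continuous_on UNIV (\<lambda>z. \<Sum>b\<in>Basis. (snd z \<bullet> b) *\<^sub>R A (fst z) b)"
    by (intro continuous_on_sum continuous_on_scaleR continuous_on_inner continuous_on_snd
        continuous_on_id continuous_on_const)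
  moreover have "(case z of (v, y) \<Rightarrow> A v y) = (\<Sum>b\<in>Basis. (snd z \<bullet> b) *\<^sub>R A (fst z) b)" for z
    by (cases z) (simp, rule expand)
  ultimately show ?thesis
    by presburger
qed

text \<open>
  The derivatives are known to be continuous in each fixed direction.  The uniform Lipschitz bound for \<open>F'\<close> on a ball follows
  from the mean value inequality, applied to \<open>v \<mapsto> F' v e\<close> for each basis vector \<open>e\<close>, and summation over the basis.
\<close>

lemma C2_derivative_bounds:
  fixes F :: "'a::euclidean_space \<Rightarrow> 'b::real_normed_vector"
  assumes "C_k_on (Suc (Suc 0)) UNIV F"
  obtains F' where "\<And>v. (F has_derivative F' v) (at v)" "continuous_on UNIV (\<lambda>(v, z). F' v z)"
    "\<And>B. \<exists>L>0. \<forall>v\<in>cball 0 B. \<forall>w\<in>cball 0 B. \<forall>z. norm (F' v z) \<le> L * norm z \<and>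
      norm (F' v z - F' w z) \<le> L * norm (v - w) * norm z"
proof -
  obtain F' where *: "\<forall>v\<in>UNIV. (F has_derivative F' v) (at v within UNIV)"
    and C1: "\<And>z. C_k_on (Suc 0) UNIV (\<lambda>v. F' v z)"
    using C_k_on.simps(2)[THEN iffD1, OF assms] by blast
  have F': "(F has_derivative F' v) (at v)" for v
    using * by simp
  have "\<exists>F''. (\<forall>v. ((\<lambda>v. F' v z) has_derivative F'' v) (at v)) \<and> (\<forall>y. continuous_on UNIV (\<lambda>v. F'' v y))" for z
    using C1[of z] by simp
  then obtain F'' where F'': "\<And>z v. ((\<lambda>v. F' v z) has_derivative F'' z v) (at v)"
    "\<And>z y. continuous_on UNIV (\<lambda>v. F'' z v y)"
    by metis
  have lin: "bounded_linear (F' v)" "bounded_linear (F'' z v)" for v z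
    using F' F'' has_derivative_bounded_linear by blast+
  have F'_cont: "continuous_on UNIV (\<lambda>v. F' v z)" for z
    by (rule has_derivative_continuous_on) (rule F'')
  have "\<exists>L>0. \<forall>v\<in>cball 0 B. \<forall>w\<in>cball 0 B. \<forall>z. norm (F' v z) \<le> L * norm z \<and>
      norm (F' v z - F' w z) \<le> L * norm (v - w) * norm z" for B
  proof -
    obtain L1 where L1: "0 < L1" "\<And>v y. v \<in> cball 0 B \<Longrightarrow> norm (F' v y) \<le> L1 * norm y"
      by (rule linear_family_bounded[of F' "cball 0 B"])
        (use lin continuous_on_subset[OF F'_cont subset_UNIV] in auto)
    have "\<exists>L. \<forall>v\<in>cball 0 B. \<forall>y. norm (F'' z v y) \<le> L * norm y" for z
    proof -
      obtain L where "\<And>v y. v \<in> cball 0 B \<Longrightarrow> norm (F'' z v y) \<le> L * norm y"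
        by (rule linear_family_bounded[of "F'' z" "cball 0 B"])
          (use lin continuous_on_subset[OF F''(2) subset_UNIV] in auto)
      then show ?thesis by blast
    qed
    then obtain l where l: "\<And>z v y. v \<in> cball 0 B \<Longrightarrow> norm (F'' z v y) \<le> l z * norm y"
      by metis
    have step: "norm (F' v e - F' w e) \<le> \<bar>l e\<bar> * norm (v - w)" if "v \<in> cball 0 B" "w \<in> cball 0 B" for v w e
    proof (rule differentiable_bound[OF convex_cball _ _ that])
      show "((\<lambda>v. F' v e) has_derivative F'' e x) (at x within cball 0 B)" for x
        by (rule has_derivative_at_withinI[OF F''(1)])
      show "onorm (F'' e x) \<le> \<bar>l e\<bar>" if "x \<in> cball 0 B" for x
        by (rule onorm_le, rule order_trans[OF l[OF that]]) (simp add: mult_right_mono)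
    qed
    define L2 where "L2 = (\<Sum>e\<in>Basis. \<bar>l e\<bar>)"
    have L2: "norm (F' v z - F' w z) \<le> L2 * norm (v - w) * norm z" if "v \<in> cball 0 B" "w \<in> cball 0 B" for v w z
    proof -
      interpret D: bounded_linear "\<lambda>z. F' v z - F' w z"
        by (intro bounded_linear_sub lin)
      have "F' v z - F' w z = (\<lambda>z. F' v z - F' w z) (\<Sum>e\<in>Basis. (z \<bullet> e) *\<^sub>R e)"
        by (simp add: euclidean_representation)
      also have "\<dots> = (\<Sum>e\<in>Basis. (z \<bullet> e) *\<^sub>R (F' v e - F' w e))"
        by (simp only: D.sum D.scaleR)
      finally have "norm (F' v z - F' w z) \<le> (\<Sum>e\<in>Basis. norm z * (\<bar>l e\<bar> * norm (v - w)))"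
        using step[OF that] Basis_le_norm[of _ z] by (auto intro!: sum_norm_le mult_mono)
      then show ?thesis
        by (simp add: L2_def sum_distrib_left sum_distrib_right mult_ac)
    qed
    have "0 \<le> L2" by (simp add: L2_def sum_nonneg)
    have "norm (F' v z) \<le> (L1 + L2) * norm z \<and> norm (F' v z - F' w z) \<le> (L1 + L2) * norm (v - w) * norm z"
      if "v \<in> cball 0 B" "w \<in> cball 0 B" for v w z
    proof
      show "norm (F' v z) \<le> (L1 + L2) * norm z"
        using L1(2)[OF that(1), of z] mult_nonneg_nonneg[OF \<open>0 \<le> L2\<close> norm_ge_zero[of z]]
        by (simp add: distrib_right)
      have "L2 * norm (v - w) * norm z \<le> (L1 + L2) * norm (v - w) * norm z"
        using L1 by (intro mult_right_mono) auto
      then show "norm (F' v z - F' w z) \<le> (L1 + L2) * norm (v - w) * norm z"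
        using L2[OF that, of z] by linarith
    qed
    then show ?thesis
      using L1(1) \<open>0 \<le> L2\<close> by (intro exI[of _ "L1 + L2"]) auto
  qed
  then show thesis
    using that F' linear_family_continuous[OF lin(1) F'_cont] by blast
qed

section \<open>Classical solutions and the fixed-point equation\<close>

lemma C_k_on_add:
  "C_k_on k S f \<Longrightarrow> C_k_on k S g \<Longrightarrow> C_k_on k S (\<lambda>x. f x + g x)"
proof (induction k arbitrary: f g)
  case 0
  then show ?case by (simp add: continuous_on_add)
next
  case (Suc k)
  obtain f' where f': "\<forall>x\<in>S. (f has_derivative f' x) (at x within S)" "\<forall>v. C_k_on k S (\<lambda>x. f' x v)"
    using Suc.prems(1) by auto
  obtain g' where g': "\<forall>x\<in>S. (g has_derivative g' x) (at x within S)" "\<forall>v. C_k_on k S (\<lambda>x. g' x v)"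
    using Suc.prems(2) by auto
  show ?case
    unfolding C_k_on.simps
    by (rule exI[of _ "\<lambda>x v. f' x v + g' x v"]) (use f' g' Suc.IH in \<open>simp add: has_derivative_add\<close>)
qed

lemma C_k_on_scaleR:
  "C_k_on k S f \<Longrightarrow> C_k_on k S (\<lambda>x. c *\<^sub>R f x)"
proof (induction k arbitrary: f)
  case 0
  then show ?case by (simp add: continuous_on_scaleR)
next
  case (Suc k)
  obtain f' where f': "\<forall>x\<in>S. (f has_derivative f' x) (at x within S)" "\<forall>v. C_k_on k S (\<lambda>x. f' x v)"
    using Suc.prems(1) by auto
  show ?case
    unfolding C_k_on.simps
    by (rule exI[of _ "\<lambda>x v. c *\<^sub>R f' x v"]) (use f' Suc.IH in \<open>simp add: has_derivative_scaleR_right\<close>)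
qed

lemma C_k_on_SucI:
  assumes "\<And>t x. 0 \<le> t \<Longrightarrow>
      (u has_derivative (\<lambda>(\<tau>, \<xi>). \<tau> *\<^sub>R ut (t, x) + \<xi> *\<^sub>R ux (t, x))) (at (t, x) within half_plane)"
    and "C_k_on k half_plane ut" "C_k_on k half_plane ux"
  shows "C_k_on (Suc k) half_plane u"
  unfolding C_k_on.simps
proof (intro exI[of _ "\<lambda>z (\<tau>, \<xi>). \<tau> *\<^sub>R ut z + \<xi> *\<^sub>R ux z"] conjI ballI allI)
  show "(u has_derivative (\<lambda>(\<tau>, \<xi>). \<tau> *\<^sub>R ut z + \<xi> *\<^sub>R ux z)) (at z within half_plane)" if "z \<in> half_plane" for z
    using assms(1)[of "fst z" "snd z"] that by auto
  show "C_k_on k half_plane (\<lambda>z. case v of (\<tau>, \<xi>) \<Rightarrow> \<tau> *\<^sub>R ut z + \<xi> *\<^sub>R ux z)" for v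
    by (cases v) (simp add: C_k_on_add C_k_on_scaleR assms)
qed

lemma at_within_half_line_neq_bot:
  assumes "0 \<le> (t::real)"
  shows "at t within {0..} \<noteq> bot"
proof
  assume "at t within {0..} = bot"
  moreover have "at_right t \<le> at t within {0..}"
    by (rule at_le) (use assms in auto)
  ultimately show False
    using trivial_limit_at_right_real[of t] by (simp add: bot.extremum_unique)
qed

lemma derivative_along_line:
  assumes u: "(u has_derivative D) (at (t, y - c * t) within half_plane)" and t: "0 \<le> t"
  shows "((\<lambda>s. u (s, y - c * s)) has_vector_derivative D (1, - c)) (at t within {0..})"
proof -
  interpret D: bounded_linear D by (rule has_derivative_bounded_linear[OF u])
  have line: "((\<lambda>s. (s, y - c * s)) has_derivative (\<lambda>h. h *\<^sub>R (1, - c))) (at t within {0..})"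
    by (auto intro!: derivative_eq_intros)
  have "(\<lambda>s. (s, y - c * s)) ` {0..} \<subseteq> half_plane"
    by auto
  then have "(u has_derivative D) (at (t, y - c * t) within (\<lambda>s. (s, y - c * s)) ` {0..})"
    by (rule has_derivative_subset[OF u])
  from has_derivative_in_compose[OF line this]
  have "((\<lambda>s. u (s, y - c * s)) has_derivative (\<lambda>h. D (h *\<^sub>R (1, - c)))) (at t within {0..})" .
  then show ?thesis
    unfolding has_vector_derivative_def D.scaleR .
qed

lemma partial_t:
  assumes "(u has_derivative D) (at (t, x) within half_plane)" "0 \<le> t"
  shows "((\<lambda>s. u (s, x)) has_vector_derivative D (1, 0)) (at t within {0..})"
  using derivative_along_line[of u D t x 0] assms by simp

lemma partial_x:
  assumes u: "(u has_derivative D) (at (t, x) within half_plane)" and t: "0 \<le> t"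
  shows "((\<lambda>y. u (t, y)) has_vector_derivative D (0, 1)) (at x)"
proof -
  interpret D: bounded_linear D by (rule has_derivative_bounded_linear[OF u])
  have line: "((\<lambda>y. (t, y)) has_derivative (\<lambda>h. h *\<^sub>R (0, 1))) (at x)"
    by (auto intro!: derivative_eq_intros)
  have "range (\<lambda>y. (t, y)) \<subseteq> half_plane"
    using t by auto
  then have "(u has_derivative D) (at (t, x) within range (\<lambda>y. (t, y)))"
    by (rule has_derivative_subset[OF u])
  from has_derivative_in_compose[OF line this]
  have "((\<lambda>y. u (t, y)) has_derivative (\<lambda>h. D (h *\<^sub>R (0, 1)))) (at x)" .
  then show ?thesis
    unfolding has_vector_derivative_def D.scaleR .
qed

lemma d_t_eq:
  assumes "((\<lambda>s. u (s, x)) has_vector_derivative d) (at t within {0..})" "0 \<le> t"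
  shows "d_t u (t, x) = d"
  using vector_derivative_within[OF at_within_half_line_neq_bot assms(1)] assms(2) by (simp add: d_t_def)

lemma d_x_eq:
  assumes "((\<lambda>y. u (t, y)) has_vector_derivative d) (at x)"
  shows "d_x u (t, x) = d"
  using vector_derivative_at[OF assms] by (simp add: d_x_def)

text \<open>
  Write \<open>u(t,x) = u(0,x) + \<integral> u\<^sub>t(s,x) ds\<close> over \<open>0 \<le> s \<le> t\<close>, differentiate under the integral in \<open>x\<close>, and then in \<open>t\<close> by the
  fundamental theorem of calculus.  This version of the symmetry of second derivatives also covers the boundary \<open>t = 0\<close>.
\<close>

lemma mixed_partials:
  fixes u :: "real \<times> real \<Rightarrow> 'b::banach"
  assumes ut: "\<And>t x. 0 \<le> t \<Longrightarrow> ((\<lambda>s. u (s, x)) has_vector_derivative ut (t, x)) (at t within {0..})"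
    and ux: "\<And>t x. 0 \<le> t \<Longrightarrow> ((\<lambda>y. u (t, y)) has_vector_derivative ux (t, x)) (at x)"
    and utx: "\<And>t x. 0 \<le> t \<Longrightarrow> ((\<lambda>y. ut (t, y)) has_vector_derivative utx (t, x)) (at x)"
    and cont: "continuous_on half_plane ut" "continuous_on half_plane utx" and t: "0 \<le> t"
  shows "((\<lambda>s. ux (s, x)) has_vector_derivative utx (t, x)) (at t within {0..})"
proof -
  have u: "u (t, x) = u (0, x) + duhamel 0 ut (t, x)" if "0 \<le> t" for t x
    using duhamel_unique[OF cont(1) that, of u 0 x] ut by simp
  have eq: "ux (t, x) = ux (0, x) + duhamel 0 utx (t, x)" if "0 \<le> t" for t x
  proof -
    have "((\<lambda>y. u (0, y) + duhamel 0 ut (t, y)) has_vector_derivative ux (0, x) + duhamel 0 utx (t, x)) (at x)"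
      by (rule has_vector_derivative_add[OF ux duhamel_derivative_x[OF cont utx]]) auto
    then show ?thesis
      using ux[OF that, of x] u[OF that] by (auto intro: vector_derivative_unique_at)
  qed
  have "((\<lambda>s. ux (0, x) + duhamel 0 utx (s, x)) has_vector_derivative utx (t, x)) (at t within {0..})"
    using duhamel_derivative_char[OF cont(2) t, of 0 x]
      has_vector_derivative_add[OF has_vector_derivative_const[of "ux (0, x)"]] by fastforce
  then show ?thesis
    by (rule has_vector_derivative_transform[rotated 2]) (use t in simp, rule eq, simp)
qed

text \<open>
  The equation prescribes only \<open>(u\<^sub>\<xi>)\<^sub>\<eta>\<close>.  The symmetry of the mixed derivatives shows that \<open>(u\<^sub>\<eta>)\<^sub>\<xi>\<close> has the same value,
  so both \<open>u\<^sub>\<xi>\<close> and \<open>u\<^sub>\<eta>\<close> are given by integrals along characteristics.  The argument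
  \<open>y = x + t\<close> of the data is twice the coordinate \<open>\<xi>\<close>, hence \<open>f'(y/2)\<close>.
\<close>

lemma classical_solution_fixpoint:
  fixes F :: "(real^'n) \<times> (real^'n) \<Rightarrow> real^'n"
  assumes sol: "global_classical_solution F f u0 u1 w"
    and F: "continuous_on UNIV F" and f': "continuous_on UNIV (Dx f)"
    and u0: "\<And>x. (u0 has_vector_derivative Dx u0 x) (at x)"
  defines "V \<equiv> \<lambda>(t, x). (Dx f ((x + t) / 2) + d_xi w (t, x), d_eta w (t, x))"
  shows "continuous_on half_plane V"
    and "z \<in> half_plane \<Longrightarrow> V z = wave_data (\<lambda>y. Dx f (y / 2) + (u1 y + Dx u0 y)) (\<lambda>y. u1 y - Dx u0 y) z +
      wave_op (\<lambda>z. F (V z)) z"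
    and "0 \<le> t \<Longrightarrow> w (t, x) = u0 x + duhamel 0 (\<lambda>z. (1/2) *\<^sub>R (d_xi w z + d_eta w z)) (t, x)"
proof -
  have C2: "C_k_on (Suc (Suc 0)) half_plane w"
    and eq: "\<And>t x. 0 \<le> t \<Longrightarrow> d_eta (d_xi w) (t, x) = F (Dx f ((t + x) / 2) + d_xi w (t, x), d_eta w (t, x))"
    and ini: "\<And>x. w (0, x) = u0 x" "\<And>x. d_t w (0, x) = u1 x"
    using sol by (auto simp: global_classical_solution_def numeral_2_eq_2)
  obtain w' where w': "\<forall>z\<in>half_plane. (w has_derivative w' z) (at z within half_plane)"
    and C1: "\<forall>v. C_k_on (Suc 0) half_plane (\<lambda>z. w' z v)"
    using C_k_on.simps(2)[THEN iffD1, OF C2] by blast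
  obtain wt' where wt': "\<forall>z\<in>half_plane. ((\<lambda>z. w' z (1, 0)) has_derivative wt' z) (at z within half_plane)"
    and wt'c: "\<forall>v. C_k_on 0 half_plane (\<lambda>z. wt' z v)"
    using C_k_on.simps(2)[THEN iffD1, OF C1[rule_format, of "(1, 0)"]] by blast
  obtain wx' where wx': "\<forall>z\<in>half_plane. ((\<lambda>z. w' z (0, 1)) has_derivative wx' z) (at z within half_plane)"
    and wx'c: "\<forall>v. C_k_on 0 half_plane (\<lambda>z. wx' z v)"
    using C_k_on.simps(2)[THEN iffD1, OF C1[rule_format, of "(0, 1)"]] by blast
  have cont: "continuous_on half_plane (\<lambda>z. w' z (1, 0))" "continuous_on half_plane (\<lambda>z. w' z (0, 1))"
    using wt' wx' by (auto intro!: has_derivative_continuous_on simp del: mem_Sigma_iff)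
  have d: "d_t w (t, x) = w' (t, x) (1, 0)" "d_x w (t, x) = w' (t, x) (0, 1)" if "0 \<le> t" for t x
    using that w' by (auto intro!: d_t_eq d_x_eq partial_t partial_x)
  have sym: "wx' (t, x) (1, 0) = wt' (t, x) (0, 1)" if t: "0 \<le> t" for t x
  proof (rule vector_derivative_unique_within[OF at_within_half_line_neq_bot[OF t]])
    show "((\<lambda>s. w' (s, x) (0, 1)) has_vector_derivative wx' (t, x) (1, 0)) (at t within {0..})"
      using t wx' by (intro partial_t) auto
    show "((\<lambda>s. w' (s, x) (0, 1)) has_vector_derivative wt' (t, x) (0, 1)) (at t within {0..})"
    proof (rule mixed_partials[OF _ _ _ cont(1) _ t])
      show "((\<lambda>s. w (s, x)) has_vector_derivative w' (t, x) (1, 0)) (at t within {0..})"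
        "((\<lambda>y. w (t, y)) has_vector_derivative w' (t, x) (0, 1)) (at x)"
        "((\<lambda>y. w' (t, y) (1, 0)) has_vector_derivative wt' (t, x) (0, 1)) (at x)" if "0 \<le> t" for t x
        using that w' wt' by (auto intro!: partial_t partial_x)
      show "continuous_on half_plane (\<lambda>z. wt' z (0, 1))"
        using wt'c by simp
    qed
  qed
  define p where "p z = w' z (1, 0) + w' z (0, 1)" for z
  define q where "q z = w' z (1, 0) - w' z (0, 1)" for z
  have pq: "d_xi w z = p z" "d_eta w z = q z" if "z \<in> half_plane" for z
    using that d by (auto simp: d_xi_def d_eta_def p_def q_def)
  have p': "(p has_derivative (\<lambda>v. wt' z v + wx' z v)) (at z within half_plane)" if "z \<in> half_plane" for z
    unfolding p_def[abs_def] using that wt' wx' by (intro has_derivative_add) auto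
  have q': "(q has_derivative (\<lambda>v. wt' z v - wx' z v)) (at z within half_plane)" if "z \<in> half_plane" for z
    unfolding q_def[abs_def] using that wt' wx' by (intro has_derivative_diff) auto
  have p_cont: "continuous_on half_plane p" and q_cont: "continuous_on half_plane q"
    unfolding p_def[abs_def] q_def[abs_def] using cont by (simp_all add: continuous_on_add continuous_on_diff)
  define h where "h = (\<lambda>(t, x). F (Dx f ((x + t) / 2) + p (t, x), q (t, x)))"
  have g_cont: "continuous_on half_plane (\<lambda>z. Dx f ((snd z + fst z) / 2))"
    by (rule continuous_on_compose2[OF f']) (intro continuous_intros, simp_all)
  then have Vpq_cont: "continuous_on half_plane (\<lambda>z. (Dx f ((snd z + fst z) / 2) + p z, q z))"
    by (intro continuous_on_Pair continuous_on_add p_cont q_cont)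
  have h_cont: "continuous_on half_plane h"
    unfolding h_def split_beta prod.collapse
    by (rule continuous_on_compose2[OF F Vpq_cont]) simp
  have V_eq: "V z = (Dx f ((snd z + fst z) / 2) + p z, q z)" if "z \<in> half_plane" for z
    using pq[OF that] by (simp add: V_def split_beta)
  show "continuous_on half_plane V"
    using Vpq_cont by (rule continuous_on_eq) (simp add: V_eq)
  have dp: "d_eta (d_xi w) (t, x) = wt' (t, x) (1, -1) + wx' (t, x) (1, -1)" if t: "0 \<le> t" for t x
  proof -
    have z: "(t, x) \<in> half_plane" using t by simp
    interpret D: bounded_linear "\<lambda>v. wt' (t, x) v + wx' (t, x) v"
      by (rule has_derivative_bounded_linear[OF p'[OF z]])
    have "(d_xi w has_derivative (\<lambda>v. wt' (t, x) v + wx' (t, x) v)) (at (t, x) within half_plane)"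
      by (rule has_derivative_transform[OF z _ p'[OF z]]) (simp add: pq)
    from d_t_eq[OF partial_t[OF this t] t] d_x_eq[OF partial_x[OF this t]]
    show ?thesis
      using D.diff[of "(1, 0)" "(0, 1)"] by (simp add: d_eta_def)
  qed
  have h_p: "wt' (t, x) (1, -1) + wx' (t, x) (1, -1) = h (t, x)" if "0 \<le> t" for t x
    using eq[OF that] dp[OF that] pq[of "(t, x)"] that by (simp add: h_def add.commute)
  have h_q: "wt' (t, x) (1, 1) - wx' (t, x) (1, 1) = h (t, x)" if t: "0 \<le> t" for t x
  proof -
    interpret T: bounded_linear "wt' (t, x)"
      by (rule has_derivative_bounded_linear, rule wt'[rule_format]) (use t in simp)
    interpret X: bounded_linear "wx' (t, x)"
      by (rule has_derivative_bounded_linear, rule wx'[rule_format]) (use t in simp)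
    have "wt' (t, x) (1, -1) = wt' (t, x) (1, 0) - wt' (t, x) (0, 1)"
      "wx' (t, x) (1, -1) = wx' (t, x) (1, 0) - wx' (t, x) (0, 1)"
      "wt' (t, x) (1, 1) = wt' (t, x) (1, 0) + wt' (t, x) (0, 1)"
      "wx' (t, x) (1, 1) = wx' (t, x) (1, 0) + wx' (t, x) (0, 1)"
      using T.diff[of "(1, 0)" "(0, 1)"] X.diff[of "(1, 0)" "(0, 1)"]
        T.add[of "(1, 0)" "(0, 1)"] X.add[of "(1, 0)" "(0, 1)"] by simp_all
    then show ?thesis
      unfolding h_p[OF t, symmetric] by (simp add: sym[OF t])
  qed
  have p_int: "p (t, x) = p (0, x + t) + duhamel 1 h (t, x)" if "0 \<le> t" for t x
    using duhamel_unique[OF h_cont that, of p 1 x] derivative_along_line[OF p', of _ _ 1] h_p by simp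
  have q_int: "q (t, x) = q (0, x - t) + duhamel (-1) h (t, x)" if "0 \<le> t" for t x
    using duhamel_unique[OF h_cont that, of q "-1" x] derivative_along_line[OF q', of _ _ "-1"] h_q by simp
  have init: "p (0, x) = u1 x + Dx u0 x" "q (0, x) = u1 x - Dx u0 x" for x
  proof -
    have "((\<lambda>y. w (0, y)) has_vector_derivative w' (0, x) (0, 1)) (at x)"
      using w' by (intro partial_x) auto
    then have "w' (0, x) (0, 1) = Dx u0 x"
      using u0[of x] by (auto simp: ini intro: vector_derivative_unique_at)
    then show "p (0, x) = u1 x + Dx u0 x" "q (0, x) = u1 x - Dx u0 x"
      using ini(2)[of x] d[of 0 x] by (simp_all add: p_def q_def)
  qed
  have wave_op_h: "wave_op (\<lambda>z. F (V z)) (t, x) = wave_op h (t, x)" if "0 \<le> t" for t x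
    unfolding wave_op_def duhamel_def prod.case
    by (intro arg_cong2[of _ _ _ _ Pair] integral_cong) (simp_all add: V_eq h_def)
  show "V z = wave_data (\<lambda>y. Dx f (y / 2) + (u1 y + Dx u0 y)) (\<lambda>y. u1 y - Dx u0 y) z +
      wave_op (\<lambda>z. F (V z)) z" if "z \<in> half_plane" for z
    using that p_int[of "fst z" "snd z"] q_int[of "fst z" "snd z"] V_eq[OF that] wave_op_h[of "fst z" "snd z"]
    by (cases z) (simp add: wave_data_def wave_op_def init add.assoc)
  show "w (t, x) = u0 x + duhamel 0 (\<lambda>z. (1/2) *\<^sub>R (d_xi w z + d_eta w z)) (t, x)" if t: "0 \<le> t" for t x
  proof -
    have "((\<lambda>s. w (s, y)) has_vector_derivative w' (s, y) (1, 0)) (at s within {0..})" if "0 \<le> s" for s y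
      using that w' by (intro partial_t) auto
    then have "w (t, x) = w (0, x) + duhamel 0 (\<lambda>z. w' z (1, 0)) (t, x)"
      using duhamel_unique[OF cont(1) t, of w 0 x] by simp
    also have "duhamel 0 (\<lambda>z. w' z (1, 0)) (t, x) = duhamel 0 (\<lambda>z. (1/2) *\<^sub>R (d_xi w z + d_eta w z)) (t, x)"
      unfolding duhamel_def prod.case
      by (intro integral_cong) (simp add: pq p_def q_def scaleR_2[symmetric])
    finally show ?thesis
      by (simp add: ini)
  qed
qed

text \<open>
  Let \<open>p\<close>, \<open>q\<close> be the candidates for \<open>u\<^sub>\<xi>\<close>, \<open>u\<^sub>\<eta>\<close>, and define \<open>u\<close> by \<open>u\<^sub>t = (p + q)/2\<close>.  That also
  \<open>u\<^sub>x = (p - q)/2\<close> is the compatibility \<open>p\<^sub>x + q\<^sub>x = p\<^sub>t - q\<^sub>t\<close>: the source terms of the two transport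
  equations are equal and cancel.
\<close>

lemma fixpoint_classical_solution:
  fixes F :: "(real^'n) \<times> (real^'n) \<Rightarrow> real^'n"
  assumes V: "continuous_on half_plane V" and Z: "continuous_on half_plane Z" and F: "continuous_on UNIV F"
    and VZ: "\<And>t x. 0 \<le> t \<Longrightarrow> ((\<lambda>x. V (t, x)) has_vector_derivative Z (t, x)) (at x)"
    and fix_V: "\<And>z. z \<in> half_plane \<Longrightarrow> V z = wave_data (\<lambda>y. Dx f (y / 2) + (u1 y + Dx u0 y)) (\<lambda>y. u1 y - Dx u0 y) z +
      wave_op (\<lambda>z. F (V z)) z"
    and f'': "\<And>y. (Dx f has_vector_derivative Dx (Dx f) y) (at y)" "continuous_on UNIV (Dx (Dx f))"
    and u0: "\<And>x. (u0 has_vector_derivative Dx u0 x) (at x)"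
  shows "\<exists>u. global_classical_solution F f u0 u1 u"
proof -
  define h where "h z = F (V z)" for z
  have h: "continuous_on half_plane h"
    unfolding h_def[abs_def] by (rule continuous_on_compose2[OF F V]) simp
  define p where "p = (\<lambda>(t, x). fst (V (t, x)) - Dx f ((x + t) / 2))"
  define q where "q z = snd (V z)" for z
  define px where "px = (\<lambda>(t, x). fst (Z (t, x)) - (1/2) *\<^sub>R Dx (Dx f) ((x + t) / 2))"
  define qx where "qx z = snd (Z z)" for z
  have p_eq: "p (t, x) = u1 (x + t) + Dx u0 (x + t) + duhamel 1 h (t, x)" if "0 \<le> t" for t x
    using fix_V[of "(t, x)"] that by (simp add: p_def wave_data_def wave_op_def h_def[abs_def])
  have q_eq: "q (t, x) = u1 (x - t) - Dx u0 (x - t) + duhamel (-1) h (t, x)" if "0 \<le> t" for t x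
    using fix_V[of "(t, x)"] that by (simp add: q_def wave_data_def wave_op_def h_def[abs_def])
  have f': "continuous_on UNIV (Dx f)"
    using f''(1) has_vector_derivative_continuous by (intro continuous_at_imp_continuous_on) blast
  have half: "continuous_on half_plane (\<lambda>z. (snd z + fst z) / (2::real))"
    by (intro continuous_intros) auto
  have cont: "continuous_on half_plane p" "continuous_on half_plane q" "continuous_on half_plane px" "continuous_on half_plane qx"
    unfolding p_def q_def[abs_def] px_def qx_def[abs_def] split_beta prod.collapse
    by (intro continuous_on_diff continuous_on_fst continuous_on_snd continuous_on_scaleR continuous_on_const
        V Z continuous_on_compose2[OF f' half] continuous_on_compose2[OF f''(2) half] subset_UNIV)+
  have px: "((\<lambda>x. p (t, x)) has_vector_derivative px (t, x)) (at x)" if t: "0 \<le> t" for t x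
  proof -
    have "((\<lambda>x. (x + t) / 2) has_vector_derivative 1/2) (at x)"
      by (auto intro!: derivative_eq_intros)
    from vector_diff_chain_at[OF this f''(1)]
    have "((\<lambda>x. Dx f ((x + t) / 2)) has_vector_derivative (1/2) *\<^sub>R Dx (Dx f) ((x + t) / 2)) (at x)"
      by (simp add: o_def)
    moreover have "((\<lambda>x. fst (V (t, x))) has_vector_derivative fst (Z (t, x))) (at x)"
      by (rule bounded_linear.has_vector_derivative[OF bounded_linear_fst VZ[OF t]])
    ultimately show ?thesis
      by (simp add: p_def px_def has_vector_derivative_diff)
  qed
  have qx: "((\<lambda>x. q (t, x)) has_vector_derivative qx (t, x)) (at x)" if t: "0 \<le> t" for t x
    unfolding q_def qx_def by (rule bounded_linear.has_vector_derivative[OF bounded_linear_snd VZ[OF t]])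
  have p': "(p has_derivative (\<lambda>(\<tau>, \<xi>). \<tau> *\<^sub>R (px (t, x) + h (t, x)) + \<xi> *\<^sub>R px (t, x))) (at (t, x) within half_plane)"
    if t: "0 \<le> t" for t x
  proof -
    have "((\<lambda>s. u1 (x + t) + Dx u0 (x + t) + duhamel 1 h (s, x + t - 1 * s)) has_vector_derivative
        0 + h (t, x + t - 1 * t)) (at t within {0..})"
      by (rule has_vector_derivative_add[OF has_vector_derivative_const duhamel_derivative_char[OF h t]])
    then have "((\<lambda>s. p (s, x + 1 * t - 1 * s)) has_vector_derivative h (t, x)) (at t within {0..})"
      by (intro has_vector_derivative_transform[of t "{0..}" "\<lambda>s. p (s, x + 1 * t - 1 * s)"])
        (use t in \<open>simp_all add: p_eq\<close>)
    from transport_has_derivative[OF t this px cont(3)] show ?thesis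
      by simp
  qed
  have q': "(q has_derivative (\<lambda>(\<tau>, \<xi>). \<tau> *\<^sub>R (- qx (t, x) + h (t, x)) + \<xi> *\<^sub>R qx (t, x))) (at (t, x) within half_plane)"
    if t: "0 \<le> t" for t x
  proof -
    have "((\<lambda>s. u1 (x - t) - Dx u0 (x - t) + duhamel (-1) h (s, x - t - - 1 * s)) has_vector_derivative
        0 + h (t, x - t - - 1 * t)) (at t within {0..})"
      by (rule has_vector_derivative_add[OF has_vector_derivative_const duhamel_derivative_char[OF h t]])
    then have "((\<lambda>s. q (s, x + - 1 * t - - 1 * s)) has_vector_derivative h (t, x)) (at t within {0..})"
      by (intro has_vector_derivative_transform[of t "{0..}" "\<lambda>s. q (s, x + - 1 * t - - 1 * s)"])
        (use t in \<open>simp_all add: q_eq\<close>)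
    from transport_has_derivative[OF t this qx cont(4)] show ?thesis
      by simp
  qed
  define ut where "ut z = (1/2) *\<^sub>R (p z + q z)" for z
  define ux where "ux z = (1/2) *\<^sub>R (p z - q z)" for z
  define utx where "utx z = (1/2) *\<^sub>R (px z + qx z)" for z
  define u where "u = (\<lambda>(t, x). u0 x + duhamel 0 ut (t, x))"
  have ut_cont: "continuous_on half_plane ut" and ux_cont: "continuous_on half_plane ux" and utx_cont: "continuous_on half_plane utx"
    unfolding ut_def[abs_def] ux_def[abs_def] utx_def[abs_def]
    by (intro continuous_on_scaleR continuous_on_const continuous_on_add continuous_on_diff cont)+
  have utx: "((\<lambda>x. ut (t, x)) has_vector_derivative utx (t, x)) (at x)" if t: "0 \<le> t" for t x
    unfolding ut_def utx_def
    by (rule bounded_linear.has_vector_derivative[OF bounded_linear_scaleR_right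
          has_vector_derivative_add[OF px[OF t] qx[OF t]]])
  have u_t: "((\<lambda>s. u (s, x)) has_vector_derivative ut (t, x)) (at t within {0..})" if t: "0 \<le> t" for t x
    using has_vector_derivative_add[OF has_vector_derivative_const[of "u0 x"]
        duhamel_derivative_char[OF ut_cont t, of 0 x]]
    by (simp add: u_def)
  have ux_eq: "ux (t, x) = Dx u0 x + duhamel 0 utx (t, x)" if t: "0 \<le> t" for t x
  proof -
    have "ux (t, x) = ux (0, x + 0 * t) + duhamel 0 utx (t, x)"
    proof (rule duhamel_unique[OF utx_cont t])
      fix t y :: real assume t: "0 \<le> t"
      have "((\<lambda>s. p (s, y)) has_vector_derivative px (t, y) + h (t, y)) (at t within {0..})"
        using partial_t[OF p'[OF t] t] by simp
      moreover have "((\<lambda>s. q (s, y)) has_vector_derivative - qx (t, y) + h (t, y)) (at t within {0..})"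
        using partial_t[OF q'[OF t] t] by simp
      ultimately have "((\<lambda>s. (1/2) *\<^sub>R (p (s, y) - q (s, y))) has_vector_derivative
          (1/2) *\<^sub>R (px (t, y) + h (t, y) - (- qx (t, y) + h (t, y)))) (at t within {0..})"
        by (intro bounded_linear.has_vector_derivative[OF bounded_linear_scaleR_right]
            has_vector_derivative_diff)
      then show "((\<lambda>t. ux (t, y - 0 * t)) has_vector_derivative utx (t, y - 0 * t)) (at t within {0..})"
        by (simp add: ux_def utx_def)
    qed
    moreover have "ux (0, x) = Dx u0 x"
      by (simp add: ux_def p_eq q_eq duhamel_def scaleR_2[symmetric])
    ultimately show ?thesis
      by simp
  qed
  have u_x: "((\<lambda>x. u (t, x)) has_vector_derivative ux (t, x)) (at x)" if t: "0 \<le> t" for t x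
    unfolding ux_eq[OF t] u_def prod.case
    by (rule has_vector_derivative_add[OF u0 duhamel_derivative_x[OF ut_cont utx_cont utx]])
  have u': "(u has_derivative (\<lambda>(\<tau>, \<xi>). \<tau> *\<^sub>R ut (t, x) + \<xi> *\<^sub>R ux (t, x))) (at (t, x) within half_plane)"
    if t: "0 \<le> t" for t x
    by (rule has_derivative_of_partials[OF t u_t[OF t] u_x ux_cont])
  have "C_k_on (Suc 0) half_plane p"
    by (rule C_k_on_SucI[where ut="\<lambda>z. px z + h z" and ux=px])
      (simp_all add: p' continuous_on_add cont h)
  moreover have "C_k_on (Suc 0) half_plane q"
    by (rule C_k_on_SucI[where ut="\<lambda>z. - qx z + h z" and ux=qx, OF q'])
      (simp_all add: continuous_on_diff cont h)
  ultimately have "C_k_on (Suc 0) half_plane ut" "C_k_on (Suc 0) half_plane ux"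
    using C_k_on_scaleR[of "Suc 0" half_plane "\<lambda>z. p z + q z" "1/2"] C_k_on_add[of "Suc 0" half_plane p q]
      C_k_on_scaleR[of "Suc 0" half_plane "\<lambda>z. p z + - 1 *\<^sub>R q z" "1/2"]
      C_k_on_add[of "Suc 0" half_plane p "\<lambda>z. - 1 *\<^sub>R q z"] C_k_on_scaleR[of "Suc 0" half_plane q "- 1"]
    unfolding ut_def[abs_def] ux_def[abs_def] by (simp_all del: C_k_on.simps)
  then have C2: "C_k_on 2 half_plane u"
    unfolding numeral_2_eq_2 by (intro C_k_on_SucI[OF u'])
  have half_sum: "(1/2) *\<^sub>R (a + b) + (1/2) *\<^sub>R (a - b) = a" "(1/2) *\<^sub>R (a + b) - (1/2) *\<^sub>R (a - b) = b"
    for a b :: "real^'n"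
    by (simp_all add: scaleR_right_diff_distrib scaleR_right_distrib flip: scaleR_add_left)
  have d_t: "d_t u (t, x) = ut (t, x)" and d_x: "d_x u (t, x) = ux (t, x)" if "0 \<le> t" for t x
    using d_t_eq[OF u_t[OF that] that] d_x_eq[OF u_x[OF that]] by auto
  have xi: "d_xi u z = p z" and eta: "d_eta u z = q z" if "z \<in> half_plane" for z
    using that d_t[of "fst z" "snd z"] d_x[of "fst z" "snd z"] half_sum[of "p z" "q z"]
    by (auto simp: d_xi_def d_eta_def ut_def ux_def)
  have eq: "d_eta (d_xi u) (t, x) = F (Dx f ((t + x) / 2) + d_xi u (t, x), d_eta u (t, x))" if t: "0 \<le> t" for t x
  proof -
    have z: "(t, x) \<in> half_plane" using t by simp
    have "(d_xi u has_derivative (\<lambda>(\<tau>, \<xi>). \<tau> *\<^sub>R (px (t, x) + h (t, x)) + \<xi> *\<^sub>R px (t, x))) (at (t, x) within half_plane)"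
      by (rule has_derivative_transform[OF z _ p'[OF t]]) (simp add: xi)
    from d_t_eq[OF partial_t[OF this t] t] d_x_eq[OF partial_x[OF this t]]
    have "d_eta (d_xi u) (t, x) = h (t, x)"
      by (simp add: d_eta_def)
    then show ?thesis
      using xi[OF z] eta[OF z] by (simp add: h_def p_def q_def add.commute)
  qed
  have "u (0, x) = u0 x" "d_t u (0, x) = u1 x" for x
    using d_t[of 0 x] by (simp_all add: u_def duhamel_def ut_def p_eq q_eq scaleR_2[symmetric])
  then have "global_classical_solution F f u0 u1 u"
    using C2 eq by (simp add: global_classical_solution_def)
  then show ?thesis
    by (intro exI[of _ u])
qed

section \<open>Pointwise decay from weighted square norms\<close>

lemma integral_norm_square_le_L2norm:
  fixes k :: "real \<Rightarrow> 'b::real_normed_vector"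
  assumes k: "continuous_on UNIV k" and le: "L2norm k \<le> ennreal \<epsilon>" and \<epsilon>: "0 \<le> \<epsilon>"
  shows "integral {a..b} (\<lambda>y. (norm (k y))\<^sup>2) \<le> \<epsilon>\<^sup>2"
proof -
  define I where "I = (\<integral>\<^sup>+ x. ennreal ((norm (k x))\<^sup>2) \<partial>lborel)"
  have I: "I \<noteq> \<infinity>"
    using le by (auto simp: L2norm_def I_def[symmetric] top_unique)
  then have "ennreal (sqrt (enn2real I)) \<le> ennreal \<epsilon>"
    using le by (simp add: L2norm_def I_def[symmetric])
  then have "sqrt (enn2real I) \<le> \<epsilon>"
    using \<epsilon> by simp
  then have I_le: "enn2real I \<le> \<epsilon>\<^sup>2"
    by (rule sqrt_le_D)
  have "continuous_on {a..b} (\<lambda>y. (norm (k y))\<^sup>2)"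
    by (intro continuous_on_power continuous_on_norm continuous_on_subset[OF k]) simp
  then have "((\<lambda>y. (norm (k y))\<^sup>2) has_integral integral {a..b} (\<lambda>y. (norm (k y))\<^sup>2)) {a..b}"
    by (intro integrable_integral integrable_continuous_real)
  then have "ennreal (integral {a..b} (\<lambda>y. (norm (k y))\<^sup>2)) =
      (\<integral>\<^sup>+ y. ennreal ((norm (k y))\<^sup>2) * indicator {a..b} y \<partial>lborel)"
    by (intro nn_integral_has_integral_lebesgue'[symmetric]) auto
  also have "\<dots> \<le> I"
    unfolding I_def by (intro nn_integral_mono) (auto simp: indicator_def)
  finally have "enn2real (ennreal (integral {a..b} (\<lambda>y. (norm (k y))\<^sup>2))) \<le> enn2real I"
    using I by (intro enn2real_mono) (auto simp: top.not_eq_extremum)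
  moreover have "0 \<le> integral {a..b} (\<lambda>y. (norm (k y))\<^sup>2)"
    by (rule integral_nonneg) (use \<open>(_ has_integral _) _\<close> in auto)
  ultimately show ?thesis
    using I_le by simp
qed

text \<open>
  The derivative of \<open>|h|\<^sup>2\<close> is at most \<open>|h|\<^sup>2 + |h'|\<^sup>2\<close> in absolute value, so \<open>|h(x)|\<^sup>2\<close> exceeds \<open>|h(y)|\<^sup>2\<close> for
  \<open>x \<le> y \<le> x + 1\<close> by at most the integral of that sum; averaging over \<open>y\<close> gives the claim.
\<close>

lemma norm_square_le_integral_unit_interval:
  fixes h h' :: "real \<Rightarrow> 'b::real_inner"
  assumes h: "\<And>x. (h has_vector_derivative h' x) (at x)" and h': "continuous_on UNIV h'"
  shows "(norm (h x))\<^sup>2 \<le> 2 * integral {x..x+1} (\<lambda>y. (norm (h y))\<^sup>2) + integral {x..x+1} (\<lambda>y. (norm (h' y))\<^sup>2)"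
proof -
  have hc: "continuous_on UNIV h"
    using h has_vector_derivative_continuous by (intro continuous_at_imp_continuous_on) blast
  have cont: "continuous_on S (\<lambda>y. (norm (h y))\<^sup>2)" "continuous_on S (\<lambda>y. (norm (h' y))\<^sup>2)" for S
    by (intro continuous_on_power continuous_on_norm
        continuous_on_subset[OF hc subset_UNIV] continuous_on_subset[OF h' subset_UNIV])+
  define J where "J = integral {x..x+1} (\<lambda>y. (norm (h y))\<^sup>2 + (norm (h' y))\<^sup>2)"
  have intble: "(\<lambda>y. (norm (h y))\<^sup>2) integrable_on {a..b}" "(\<lambda>y. (norm (h' y))\<^sup>2) integrable_on {a..b}" for a b
    by (intro integrable_continuous_real cont)+
  have le: "(norm (h x))\<^sup>2 \<le> (norm (h y))\<^sup>2 + J" if y: "y \<in> {x..x+1}" for y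
  proof -
    have "((\<lambda>y. h y \<bullet> h y) has_vector_derivative 2 * (h z \<bullet> h' z)) (at z within {x..y})" for z
      using bounded_bilinear.has_vector_derivative[OF bounded_bilinear_inner
          has_vector_derivative_at_within[OF h[of z]] has_vector_derivative_at_within[OF h[of z]]]
      by (simp add: inner_commute)
    then have int: "((\<lambda>z. 2 * (h z \<bullet> h' z)) has_integral (h y \<bullet> h y - h x \<bullet> h x)) {x..y}"
      using y by (intro fundamental_theorem_of_calculus) auto
    have "h x \<bullet> h x - h y \<bullet> h y = integral {x..y} (\<lambda>z. - (2 * (h z \<bullet> h' z)))"
      using integral_unique[OF has_integral_neg[OF int]] by (simp only: minus_diff_eq)
    also have "\<dots> \<le> integral {x..y} (\<lambda>y. (norm (h y))\<^sup>2 + (norm (h' y))\<^sup>2)"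
    proof (rule integral_le)
      show "(\<lambda>z. - (2 * (h z \<bullet> h' z))) integrable_on {x..y}"
        using has_integral_neg[OF int] by blast
      show "(\<lambda>y. (norm (h y))\<^sup>2 + (norm (h' y))\<^sup>2) integrable_on {x..y}"
        by (intro integrable_add intble)
      show "- (2 * (h z \<bullet> h' z)) \<le> (norm (h z))\<^sup>2 + (norm (h' z))\<^sup>2" for z
        using zero_le_power2[of "norm (h z + h' z)"]
        by (simp add: power2_norm_eq_inner inner_add inner_commute)
    qed
    also have "\<dots> \<le> J"
      unfolding J_def using y by (intro integral_subset_le integrable_add intble) auto
    finally show ?thesis
      by (simp add: power2_norm_eq_inner)
  qed
  have "(norm (h x))\<^sup>2 = integral {x..x+1} (\<lambda>y. (norm (h x))\<^sup>2)"
    by simp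
  also have "\<dots> \<le> integral {x..x+1} (\<lambda>y. (norm (h y))\<^sup>2 + J)"
    using le by (intro integral_le integrable_add intble) auto
  also have "\<dots> = integral {x..x+1} (\<lambda>y. (norm (h y))\<^sup>2) + J"
    by (subst integral_add) (auto intro: intble)
  also have "J = integral {x..x+1} (\<lambda>y. (norm (h y))\<^sup>2) + integral {x..x+1} (\<lambda>y. (norm (h' y))\<^sup>2)"
    unfolding J_def by (rule integral_add[OF intble])
  finally show ?thesis
    by simp
qed

lemma bracket_ge_1: "1 \<le> bracket x"
  by (simp add: bracket_def ge_one_powr_ge_zero)

lemma bracket_comparable:
  assumes "x\<^sup>2 \<le> 4 * y\<^sup>2 + 3" "0 \<le> s" "s \<le> 2"
  shows "bracket x powr s \<le> 4 * bracket y powr s"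
proof -
  have "bracket x = sqrt (1 + x\<^sup>2)"
    by (simp add: bracket_def powr_half_sqrt)
  also have "\<dots> \<le> sqrt (4 * (1 + y\<^sup>2))"
    using assms by (intro real_sqrt_le_mono) simp
  also have "\<dots> = 2 * bracket y"
    unfolding real_sqrt_mult by (simp add: bracket_def powr_half_sqrt)
  finally have "bracket x powr s \<le> (2 * bracket y) powr s"
    using bracket_ge_1[of x] assms by (intro powr_mono2) auto
  also have "\<dots> = 2 powr s * bracket y powr s"
    using bracket_ge_1[of y] by (simp add: powr_mult)
  also have "\<dots> \<le> 2 powr 2 * bracket y powr s"
    using assms by (intro mult_right_mono powr_mono) auto
  finally show ?thesis
    by simp
qed

lemma bracket_continuous: "continuous_on UNIV (\<lambda>x. bracket x powr s)"
proof -
  have pos: "1 + \<bar>x\<bar>\<^sup>2 \<noteq> 0" for x :: real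
    using zero_le_power2[of "\<bar>x\<bar>"] by linarith
  have "continuous_on UNIV bracket"
    unfolding bracket_def[abs_def]
    by (intro continuous_on_powr continuous_intros) (use pos in auto)
  moreover have "bracket x \<noteq> 0" for x
    using bracket_ge_1[of x] by linarith
  ultimately show ?thesis
    by (intro continuous_on_powr continuous_on_const) simp_all
qed

text \<open>
  The weight changes by a factor of at most 4 on an interval of length 1, so the one-dimensional Sobolev
  inequality on unit intervals needs no derivative of the weight.  The constant is \<open>7 \<ge> \<surd>48\<close>, where
  \<open>48 = 16 (2 + 1)\<close>.
\<close>

lemma weighted_sobolev:
  fixes h h' :: "real \<Rightarrow> 'b::real_inner"
  assumes h: "\<And>x. (h has_vector_derivative h' x) (at x)" and h': "continuous_on UNIV h'"
    and s: "0 \<le> s" "s \<le> 2" and \<epsilon>: "0 \<le> \<epsilon>"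
    and L2: "L2norm (\<lambda>x. bracket x powr s *\<^sub>R h x) \<le> ennreal \<epsilon>"
      "L2norm (\<lambda>x. bracket x powr s *\<^sub>R h' x) \<le> ennreal \<epsilon>"
  shows "norm (h x) \<le> 7 * \<epsilon> * bracket x powr - s"
proof -
  have hc: "continuous_on UNIV h"
    using h has_vector_derivative_continuous by (intro continuous_at_imp_continuous_on) blast
  let ?B = "\<lambda>x. bracket x powr s"
  have part: "(?B x)\<^sup>2 * integral {x..x+1} (\<lambda>y. (norm (k y))\<^sup>2) \<le> 16 * \<epsilon>\<^sup>2"
    if k: "continuous_on UNIV k" "L2norm (\<lambda>x. ?B x *\<^sub>R k x) \<le> ennreal \<epsilon>" for k :: "real \<Rightarrow> 'b"
  proof -
    have cont: "continuous_on UNIV (\<lambda>x. ?B x *\<^sub>R k x)"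
      by (intro continuous_on_scaleR bracket_continuous k)
    have "(?B x)\<^sup>2 * integral {x..x+1} (\<lambda>y. (norm (k y))\<^sup>2) = integral {x..x+1} (\<lambda>y. (?B x)\<^sup>2 * (norm (k y))\<^sup>2)"
      by simp
    also have "\<dots> \<le> integral {x..x+1} (\<lambda>y. 16 * (norm (?B y *\<^sub>R k y))\<^sup>2)"
    proof (rule integral_le)
      show "(\<lambda>y. (?B x)\<^sup>2 * (norm (k y))\<^sup>2) integrable_on {x..x+1}"
        "(\<lambda>y. 16 * (norm (?B y *\<^sub>R k y))\<^sup>2) integrable_on {x..x+1}"
        by (intro integrable_continuous_real continuous_on_mult continuous_on_power continuous_on_norm
            continuous_on_const continuous_on_subset[OF k(1)] continuous_on_subset[OF cont] subset_UNIV)+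
      fix y assume y: "y \<in> {x..x+1}"
      have "x\<^sup>2 \<le> 4 * y\<^sup>2 + 3"
      proof -
        have "(y - x)\<^sup>2 \<le> 1"
          using y by (simp add: power_le_one)
        moreover have "(y - x)\<^sup>2 = y\<^sup>2 - 2 * (x * y) + x\<^sup>2" "(2 * y - x)\<^sup>2 = 4 * y\<^sup>2 - 4 * (x * y) + x\<^sup>2"
          by (simp_all add: power2_eq_square algebra_simps)
        ultimately show ?thesis
          using zero_le_power2[of "2 * y - x"] zero_le_power2[of y] by linarith
      qed
      then have "?B x \<le> 4 * ?B y"
        by (rule bracket_comparable[OF _ s])
      then have "?B x * norm (k y) \<le> 4 * ?B y * norm (k y)"
        by (rule mult_right_mono) simp
      then have "(?B x * norm (k y))\<^sup>2 \<le> (4 * ?B y * norm (k y))\<^sup>2"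
        by (rule power_mono) simp
      then show "(?B x)\<^sup>2 * (norm (k y))\<^sup>2 \<le> 16 * (norm (?B y *\<^sub>R k y))\<^sup>2"
        by (simp add: power_mult_distrib)
    qed
    also have "\<dots> \<le> 16 * \<epsilon>\<^sup>2"
      using integral_norm_square_le_L2norm[OF cont k(2) \<epsilon>, of x "x + 1"] by simp
    finally show ?thesis .
  qed
  have "(?B x * norm (h x))\<^sup>2 \<le> (?B x)\<^sup>2 * (2 * integral {x..x+1} (\<lambda>y. (norm (h y))\<^sup>2) +
      integral {x..x+1} (\<lambda>y. (norm (h' y))\<^sup>2))"
    unfolding power_mult_distrib
    by (rule mult_left_mono[OF norm_square_le_integral_unit_interval[OF h h']]) simp
  also have "\<dots> \<le> 48 * \<epsilon>\<^sup>2"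
    using part[OF hc L2(1)] part[OF h' L2(2)] by (simp add: algebra_simps)
  also have "\<dots> \<le> (7 * \<epsilon>)\<^sup>2"
    by (simp add: power_mult_distrib)
  finally have "?B x * norm (h x) \<le> 7 * \<epsilon>"
    by (rule power2_le_imp_le) (use \<epsilon> in simp)
  then show ?thesis
    using bracket_ge_1[of x] by (simp add: powr_minus field_simps)
qed

lemma C_k_on_continuous:
  assumes "C_k_on k S f"
  shows "continuous_on S f"
proof (cases k)
  case 0
  then show ?thesis using assms by simp
next
  case (Suc m)
  then obtain f' where "\<forall>x\<in>S. (f has_derivative f' x) (at x within S)"
    using assms by auto
  then show ?thesis
    by (intro has_derivative_continuous_on) blast
qed

lemma C_k_on_Suc_Dx:
  fixes g :: "real \<Rightarrow> 'b::real_normed_vector"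
  assumes "C_k_on (Suc k) UNIV g"
  shows "(g has_vector_derivative Dx g x) (at x)" and "C_k_on k UNIV (Dx g)"
proof -
  obtain g' where g': "\<forall>x\<in>UNIV. (g has_derivative g' x) (at x within UNIV)" "\<forall>v. C_k_on k UNIV (\<lambda>x. g' x v)"
    using C_k_on.simps(2)[THEN iffD1, OF assms] by blast
  have d: "(g has_vector_derivative g' x 1) (at x)" for x
  proof -
    have gx: "(g has_derivative g' x) (at x)"
      using g' by simp
    interpret D: bounded_linear "g' x" by (rule has_derivative_bounded_linear[OF gx])
    have "g' x k = k *\<^sub>R g' x 1" for k
      using D.scaleR[of k 1] by simp
    then have "g' x = (\<lambda>k. k *\<^sub>R g' x 1)"
      by (rule ext)
    then show ?thesis
      using gx unfolding has_vector_derivative_def by metis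
  qed
  then have Dx: "Dx g = (\<lambda>x. g' x 1)"
    by (simp add: Dx_def fun_eq_iff vector_derivative_at)
  show "(g has_vector_derivative Dx g x) (at x)"
    using d by (simp add: Dx)
  show "C_k_on k UNIV (Dx g)"
    using g'(2) by (simp add: Dx)
qed

lemma wave_data_derivative_x:
  fixes a b a' b' :: "real \<Rightarrow> 'b::real_normed_vector"
  assumes "\<And>y. (a has_vector_derivative a' y) (at y)" "\<And>y. (b has_vector_derivative b' y) (at y)"
  shows "((\<lambda>x. wave_data a b (t, x)) has_vector_derivative wave_data a' b' (t, x)) (at x)"
  using has_vector_derivative_shift[of a "a' (x + t)" x t] has_vector_derivative_shift[of b "b' (x - t)" x "- t"]
    assms by (simp add: wave_data_def has_vector_derivative_Pair)

section \<open>Global stability\<close>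

text \<open>
  The bound \<open>\<epsilon>\<^sub>0\<close> is chosen after the size \<open>M\<close> of the first datum: \<open>M\<close> determines the ball on which the
  constant \<open>C\<close> of the null condition is taken, then \<open>\<Lambda>\<close>, and finally the smallness of the second datum.
\<close>

lemma small_data_fixpoint:
  fixes F :: "'b::euclidean_space \<times> 'b \<Rightarrow> 'b"
  assumes F: "\<And>v. (F has_derivative F' v) (at v)" and F'_cont: "continuous_on UNIV (\<lambda>(v, z). F' v z)"
    and F'_bounds: "\<And>B. \<exists>L>0. \<forall>v\<in>cball 0 B. \<forall>w\<in>cball 0 B. \<forall>z. norm (F' v z) \<le> L * norm z \<and>
      norm (F' v z - F' w z) \<le> L * norm (v - w) * norm z"
    and F_null: "\<And>R. \<exists>C. \<forall>\<rho>\<in>cball 0 R. \<forall>\<theta>\<in>cball 0 R. norm (F (\<rho>, \<theta>)) \<le> C * norm \<rho> * norm \<theta>"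
    and \<delta>: "0 < \<delta>" "\<delta> < 1" and M: "0 \<le> M"
  shows "\<exists>\<epsilon>0>0. \<forall>a b a' b' \<epsilon>.
    (\<forall>y. (a has_vector_derivative a' y) (at y)) \<longrightarrow> (\<forall>y. (b has_vector_derivative b' y) (at y)) \<longrightarrow>
    continuous_on UNIV a' \<longrightarrow> continuous_on UNIV b' \<longrightarrow>
    (\<forall>y. norm (a y) \<le> M * bracket y powr - (1 + \<delta>)) \<longrightarrow>
    (\<forall>y. norm (b y) \<le> \<epsilon> * bracket y powr - (1 + \<delta>)) \<longrightarrow> 0 \<le> \<epsilon> \<longrightarrow> \<epsilon> \<le> \<epsilon>0 \<longrightarrow>
    (\<exists>V Z. continuous_on half_plane V \<and> continuous_on half_plane Z \<and>
      (\<forall>t\<ge>0. \<forall>x. ((\<lambda>x. V (t, x)) has_vector_derivative Z (t, x)) (at x)) \<and>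
      (\<forall>z\<in>half_plane. V z = wave_data a b z + wave_op (\<lambda>z. F (V z)) z))"
proof -
  obtain W w :: "real \<Rightarrow> real" where W: "\<And>y. (W has_real_derivative w y) (at y)" "\<And>y. 0 \<le> W y"
    "\<And>y. W y \<le> 6 / \<delta>" and w: "\<And>y. bracket y powr - (1 + \<delta>) \<le> w y" "\<And>y. w y \<le> 3"
    using integrable_weight[OF \<delta>] by blast
  have w0: "0 \<le> w y" for y
    using w(1)[of y] powr_ge_zero order_trans by blast
  \<comment> \<open>The weight is at most 3, so both components stay below \<open>R\<close> and the pair stays in the ball of radius \<open>2 R\<close>.\<close>
  define R where "R = (M + 1) * 3"
  have R: "3 \<le> R"
    using M by (simp add: R_def)
  obtain C0 where C0: "\<forall>\<rho>\<in>cball 0 R. \<forall>\<theta>\<in>cball 0 R. norm (F (\<rho>, \<theta>)) \<le> C0 * norm \<rho> * norm \<theta>"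
    using F_null[of R] by blast
  define C where "C = \<bar>C0\<bar>"
  have C: "0 \<le> C" "norm (F (\<rho>, \<theta>)) \<le> C * norm \<rho> * norm \<theta>" if "norm \<rho> \<le> R" "norm \<theta> \<le> R" for \<rho> \<theta>
  proof -
    have "C0 * norm \<rho> * norm \<theta> \<le> C * norm \<rho> * norm \<theta>"
      by (intro mult_right_mono) (auto simp: C_def)
    then show "norm (F (\<rho>, \<theta>)) \<le> C * norm \<rho> * norm \<theta>"
      using C0[rule_format, of \<rho> \<theta>] that by simp
  qed (simp add: C_def)
  have C_nonneg: "0 \<le> C" by (simp add: C_def)
  define \<Lambda> where "\<Lambda> = C * (M + 1) / 2"
  define B where "B = 6 / \<delta>"
  \<comment> \<open>The inequality \<open>\<epsilon> Q \<le> 1\<close> contains both smallness conditions of the weighted bounds.\<close>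
  define Q where "Q = exp (\<Lambda> * B) * (1 + C * (M + 1) * B)"
  have CMB: "0 \<le> C * (M + 1) * B"
    using C_nonneg M \<delta> by (simp add: B_def)
  then have Q: "0 < Q"
    by (simp add: Q_def add_pos_nonneg)
  obtain L where L: "0 < L" "\<And>v w z. v \<in> cball 0 (2 * R) \<Longrightarrow> w \<in> cball 0 (2 * R) \<Longrightarrow>
      norm (F' v z) \<le> L * norm z \<and> norm (F' v z - F' w z) \<le> L * norm (v - w) * norm z"
    using F'_bounds[of "2 * R"] by blast
  have F_cont: "continuous_on UNIV F"
    by (rule has_derivative_continuous_on) (rule F)
  show ?thesis
  proof (intro exI[of _ "1 / Q"] conjI allI impI)
    show "0 < 1 / Q" using Q by simp
    fix a b a' b' :: "real \<Rightarrow> 'b" and \<epsilon> :: real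
    assume "\<forall>y. (a has_vector_derivative a' y) (at y)" "\<forall>y. (b has_vector_derivative b' y) (at y)"
      and a': "continuous_on UNIV a'" and b': "continuous_on UNIV b'"
      and "\<forall>y. norm (a y) \<le> M * bracket y powr - (1 + \<delta>)"
      and "\<forall>y. norm (b y) \<le> \<epsilon> * bracket y powr - (1 + \<delta>)"
      and \<epsilon>: "0 \<le> \<epsilon>" "\<epsilon> \<le> 1 / Q"
    then have a: "(a has_vector_derivative a' y) (at y)" and b: "(b has_vector_derivative b' y) (at y)"
      and a_le: "norm (a y) \<le> M * bracket y powr - (1 + \<delta>)"
      and b_le: "norm (b y) \<le> \<epsilon> * bracket y powr - (1 + \<delta>)" for y
      by blast+
    have cont: "continuous_on UNIV a" "continuous_on UNIV b"
      using a b has_vector_derivative_continuous by (intro continuous_at_imp_continuous_on; blast)+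
    have \<epsilon>Q: "\<epsilon> * exp (\<Lambda> * B) + (C * (M + 1) * B) * (\<epsilon> * exp (\<Lambda> * B)) \<le> 1"
      using \<epsilon> Q by (simp add: Q_def field_simps)
    have \<epsilon>e: "0 \<le> \<epsilon> * exp (\<Lambda> * B)"
      using \<epsilon> by simp
    have small: "\<epsilon> * exp (\<Lambda> * B) \<le> 1" "(C * (M + 1) * B) * (\<epsilon> * exp (\<Lambda> * B)) \<le> 1"
      using \<epsilon>Q \<epsilon>e mult_nonneg_nonneg[OF CMB \<epsilon>e] by linarith+
    have bound: "norm (picard F (wave_data a b) n (t, x)) \<le> 2 * R" if "0 \<le> t" for n t x
    proof (rule picard_weighted_bound(3)[where W=W and w=w and B=B and k=3 and M=M and \<epsilon>=\<epsilon> and C=C and \<Lambda>=\<Lambda>])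
      show "norm (a y) \<le> M * w y" for y
        using a_le[of y] mult_left_mono[OF w(1)[of y] M] by linarith
      show "norm (b y) \<le> \<epsilon> * w y" for y
        using b_le[of y] mult_left_mono[OF w(1)[of y] \<epsilon>(1)] by linarith
      show "\<epsilon> * 3 * exp (\<Lambda> * B) \<le> R"
        using small(1) R by linarith
      show "C * (M + 1) * (\<epsilon> * exp (\<Lambda> * B)) * B \<le> 2"
        using small(2) by (simp add: mult_ac)
    qed (use F_cont cont W w w0 C C_nonneg M \<epsilon> that in \<open>auto simp: R_def \<Lambda>_def B_def\<close>)
    interpret picard_scheme F F' "wave_data a b" "wave_data a' b'" "cball 0 (2 * R)" L
    proof
      show "picard F (wave_data a b) n z \<in> cball 0 (2 * R)" if "z \<in> half_plane" for n z
        using bound[of "fst z" n "snd z"] that by auto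
      show "continuous_on half_plane (wave_data a b)" "continuous_on half_plane (wave_data a' b')"
        by (intro wave_data_continuous cont a' b')+
      show "norm (F' v z) \<le> L * norm z" if "v \<in> cball 0 (2 * R)" for v z
        using L(2)[OF that that] by blast
      show "norm (F' v z - F' w z) \<le> L * norm (v - w) * norm z"
        if "v \<in> cball 0 (2 * R)" "w \<in> cball 0 (2 * R)" for v w z
        using L(2)[OF that] by blast
    qed (rule F F'_cont L(1) wave_data_derivative_x[OF a b] convex_cball compact_cball)+
    show "\<exists>V Z. continuous_on half_plane V \<and> continuous_on half_plane Z \<and>
        (\<forall>t\<ge>0. \<forall>x. ((\<lambda>x. V (t, x)) has_vector_derivative Z (t, x)) (at x)) \<and>
        (\<forall>z\<in>half_plane. V z = wave_data a b z + wave_op (\<lambda>z. F (V z)) z)"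
      by (intro exI[of _ V_lim] exI[of _ Z_lim] conjI allI ballI impI
          V_lim_continuous Z_lim_continuous V_lim_derivative V_lim_fixpoint)
  qed
qed

theorem theorem1p1:
  fixes F :: "(real^'n) \<times> (real^'n) \<Rightarrow> real^'n"
    and \<delta> M0 :: real
  assumes "smooth F"
    and "bigO_product F"
    and "0 < \<delta>" and "\<delta> < 1"
  shows "\<exists>\<epsilon>0>0. \<forall>f :: real \<Rightarrow> real^'n.
    C_k_on 2 UNIV f \<longrightarrow>
    bdd_above (range (\<lambda>x. bracket x powr (3/2 * (1 + \<delta>)) * (norm (Dx f x) + norm (Dx (Dx f) x)))) \<longrightarrow>
    M0 = (SUP x. bracket x powr (3/2 * (1 + \<delta>)) * (norm (Dx f x) + norm (Dx (Dx f) x))) \<longrightarrow>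
    (\<forall>(u0 :: real \<Rightarrow> real^'n) (u1 :: real \<Rightarrow> real^'n) (\<epsilon> :: real).
      smooth u0 \<longrightarrow> smooth u1 \<longrightarrow> 0 < \<epsilon> \<longrightarrow> \<epsilon> \<le> \<epsilon>0 \<longrightarrow>
      (\<Sum>l = 0..1::nat.
         L2norm (\<lambda>x. bracket x powr (1 + \<delta>) *\<^sub>R (Dx ^^ l) (Dx u0) x) +
         L2norm (\<lambda>x. bracket x powr (1 + \<delta>) *\<^sub>R (Dx ^^ l) u1 x)) \<le> ennreal \<epsilon> \<longrightarrow>
      (\<exists>u. global_classical_solution F f u0 u1 u \<and>
           (\<forall>w. global_classical_solution F f u0 u1 w \<longrightarrow>
                (\<forall>t\<ge>0. \<forall>x. w (t, x) = u (t, x)))))"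
proof -
  have "C_k_on (Suc (Suc 0)) UNIV F"
    using \<open>smooth F\<close> unfolding smooth_def by blast
  then obtain F' where F': "\<And>v. (F has_derivative F' v) (at v)" "continuous_on UNIV (\<lambda>(v, z). F' v z)"
    and F'_bounds: "\<And>B. \<exists>L>0. \<forall>v\<in>cball 0 B. \<forall>w\<in>cball 0 B. \<forall>z. norm (F' v z) \<le> L * norm z \<and>
      norm (F' v z - F' w z) \<le> L * norm (v - w) * norm z"
    by (rule C2_derivative_bounds) blast
  have F_cont: "continuous_on UNIV F"
    by (rule has_derivative_continuous_on) (rule F'(1))
  have F_lip: "\<exists>L>0. \<forall>v\<in>cball 0 B. \<forall>w\<in>cball 0 B. norm (F v - F w) \<le> L * norm (v - w)" for B
  proof -
    obtain L where L: "0 < L" "\<And>v z. v \<in> cball 0 B \<Longrightarrow> norm (F' v z) \<le> L * norm z"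
      using F'_bounds[of B] by blast
    have "norm (F v - F w) \<le> L * norm (v - w)" if "v \<in> cball 0 B" "w \<in> cball 0 B" for v w
    proof (rule differentiable_bound[OF convex_cball _ _ that])
      show "(F has_derivative F' x) (at x within cball 0 B)" for x
        by (rule has_derivative_at_withinI[OF F'(1)])
      show "onorm (F' x) \<le> L" if "x \<in> cball 0 B" for x
        by (rule onorm_le[OF L(2)[OF that]])
    qed
    then show ?thesis
      using L(1) by blast
  qed
  have F_null: "\<exists>C. \<forall>\<rho>\<in>cball 0 R. \<forall>\<theta>\<in>cball 0 R. norm (F (\<rho>, \<theta>)) \<le> C * norm \<rho> * norm \<theta>" for R
  proof -
    have "compact (cball 0 R \<times> cball 0 R :: ((real^'n) \<times> (real^'n)) set)"
      by (intro compact_Times compact_cball)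
    then obtain C where "\<forall>(\<rho>, \<theta>)\<in>cball 0 R \<times> cball 0 R. norm (F (\<rho>, \<theta>)) \<le> C * norm \<rho> * norm \<theta>"
      using \<open>bigO_product F\<close> unfolding bigO_product_def by blast
    then show ?thesis
      by blast
  qed
  \<comment> \<open>The factor 4 compares the weights at \<open>y/2\<close> and \<open>y\<close>; each of the two Cauchy data contributes at most \<open>7\<epsilon> \<le> 7\<close>.\<close>
  define M where "M = 4 * \<bar>M0\<bar> + 14"
  have "0 \<le> M" by (simp add: M_def)
  obtain \<epsilon>1 where \<epsilon>1: "0 < \<epsilon>1"
    and fixpoint: "\<forall>a b a' b' \<epsilon>.
    (\<forall>y. (a has_vector_derivative a' y) (at y)) \<longrightarrow> (\<forall>y. (b has_vector_derivative b' y) (at y)) \<longrightarrow>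
    continuous_on UNIV a' \<longrightarrow> continuous_on UNIV b' \<longrightarrow>
    (\<forall>y. norm (a y) \<le> M * bracket y powr - (1 + \<delta>)) \<longrightarrow>
    (\<forall>y. norm (b y) \<le> \<epsilon> * bracket y powr - (1 + \<delta>)) \<longrightarrow> 0 \<le> \<epsilon> \<longrightarrow> \<epsilon> \<le> \<epsilon>1 \<longrightarrow>
    (\<exists>V Z. continuous_on half_plane V \<and> continuous_on half_plane Z \<and>
      (\<forall>t\<ge>0. \<forall>x. ((\<lambda>x. V (t, x)) has_vector_derivative Z (t, x)) (at x)) \<and>
      (\<forall>z\<in>half_plane. V z = wave_data a b z + wave_op (\<lambda>z. F (V z)) z))"
    using small_data_fixpoint[OF F' F'_bounds F_null \<open>0 < \<delta>\<close> \<open>\<delta> < 1\<close> \<open>0 \<le> M\<close>] by blast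
  define \<epsilon>0 where "\<epsilon>0 = min 1 (\<epsilon>1 / 14)"
  show ?thesis
  proof (intro exI[of _ \<epsilon>0] conjI allI impI)
    show "0 < \<epsilon>0" using \<epsilon>1 by (simp add: \<epsilon>0_def)
    fix f u0 u1 :: "real \<Rightarrow> real^'n" and \<epsilon> :: real
    assume f: "C_k_on 2 UNIV f"
      and bdd: "bdd_above (range (\<lambda>x. bracket x powr (3/2 * (1 + \<delta>)) * (norm (Dx f x) + norm (Dx (Dx f) x))))"
      and M0: "M0 = (SUP x. bracket x powr (3/2 * (1 + \<delta>)) * (norm (Dx f x) + norm (Dx (Dx f) x)))"
      and u0: "smooth u0" and u1: "smooth u1" and \<epsilon>: "0 < \<epsilon>" "\<epsilon> \<le> \<epsilon>0"
      and data: "(\<Sum>l = 0..1::nat.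
         L2norm (\<lambda>x. bracket x powr (1 + \<delta>) *\<^sub>R (Dx ^^ l) (Dx u0) x) +
         L2norm (\<lambda>x. bracket x powr (1 + \<delta>) *\<^sub>R (Dx ^^ l) u1 x)) \<le> ennreal \<epsilon>"
    let ?s = "1 + \<delta>"
    have f2: "C_k_on (Suc 0) UNIV (Dx f)"
      by (rule C_k_on_Suc_Dx(2)) (use f in \<open>simp only: numeral_2_eq_2\<close>)
    have f'': "(Dx f has_vector_derivative Dx (Dx f) y) (at y)" "continuous_on UNIV (Dx (Dx f))" for y
      using C_k_on_Suc_Dx[OF f2] C_k_on_continuous by blast+
    have u0_C: "C_k_on (Suc (Suc 0)) UNIV u0" and u1_C: "C_k_on (Suc 0) UNIV u1"
      using u0 u1 unfolding smooth_def by blast+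
    have u0': "(u0 has_vector_derivative Dx u0 y) (at y)"
      "(Dx u0 has_vector_derivative Dx (Dx u0) y) (at y)" "continuous_on UNIV (Dx (Dx u0))" for y
      using C_k_on_Suc_Dx[OF u0_C] C_k_on_Suc_Dx[OF C_k_on_Suc_Dx(2)[OF u0_C]] C_k_on_continuous by blast+
    have u1': "(u1 has_vector_derivative Dx u1 y) (at y)" "continuous_on UNIV (Dx u1)" for y
      using C_k_on_Suc_Dx[OF u1_C] C_k_on_continuous by blast+
    have L2_le: "L2norm (\<lambda>x. bracket x powr ?s *\<^sub>R Dx u0 x) \<le> ennreal \<epsilon>"
      "L2norm (\<lambda>x. bracket x powr ?s *\<^sub>R Dx (Dx u0) x) \<le> ennreal \<epsilon>"
      "L2norm (\<lambda>x. bracket x powr ?s *\<^sub>R u1 x) \<le> ennreal \<epsilon>"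
      "L2norm (\<lambda>x. bracket x powr ?s *\<^sub>R Dx u1 x) \<le> ennreal \<epsilon>"
    proof -
      have "{0..1::nat} = {0, 1}"
        by auto
      then have data': "(L2norm (\<lambda>x. bracket x powr ?s *\<^sub>R Dx u0 x) + L2norm (\<lambda>x. bracket x powr ?s *\<^sub>R u1 x)) +
          (L2norm (\<lambda>x. bracket x powr ?s *\<^sub>R Dx (Dx u0) x) + L2norm (\<lambda>x. bracket x powr ?s *\<^sub>R Dx u1 x))
          \<le> ennreal \<epsilon>"
        using data by simp
      have le: "a \<le> e \<and> b \<le> e \<and> c \<le> e \<and> d \<le> e" if "(a + b) + (c + d) \<le> e" for a b c d e :: ennreal
        using that order_trans[of _ "(a + b) + (c + d)" e]
          add_increasing2[of "c + d" "a" "a + b"] add_increasing2[of "c + d" "b" "a + b"]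
          add_increasing[of "a + b" "c" "c + d"] add_increasing[of "a + b" "d" "c + d"] by simp
      show "L2norm (\<lambda>x. bracket x powr ?s *\<^sub>R Dx u0 x) \<le> ennreal \<epsilon>"
      "L2norm (\<lambda>x. bracket x powr ?s *\<^sub>R Dx (Dx u0) x) \<le> ennreal \<epsilon>"
      "L2norm (\<lambda>x. bracket x powr ?s *\<^sub>R u1 x) \<le> ennreal \<epsilon>"
      "L2norm (\<lambda>x. bracket x powr ?s *\<^sub>R Dx u1 x) \<le> ennreal \<epsilon>"
        using le[OF data'] by blast+
    qed
    have s: "0 \<le> ?s" "?s \<le> 2"
      using assms by auto
    have u0_le: "norm (Dx u0 y) \<le> 7 * \<epsilon> * bracket y powr - ?s" for y
      using \<epsilon> by (intro weighted_sobolev[OF u0'(2,3) s _ L2_le(1,2)]) simp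
    have u1_le: "norm (u1 y) \<le> 7 * \<epsilon> * bracket y powr - ?s" for y
      using \<epsilon> by (intro weighted_sobolev[OF u1' s _ L2_le(3,4)]) simp
    have f_le: "norm (Dx f (y / 2)) \<le> 4 * \<bar>M0\<bar> * bracket y powr - ?s" for y
    proof -
      let ?n = "norm (Dx f (y / 2))"
      have "bracket (y / 2) powr (3/2 * ?s) * (?n + norm (Dx (Dx f) (y / 2))) \<le> M0"
        unfolding M0 by (rule cSUP_upper[OF UNIV_I bdd])
      moreover have "bracket (y / 2) powr (3/2 * ?s) * ?n \<le>
          bracket (y / 2) powr (3/2 * ?s) * (?n + norm (Dx (Dx f) (y / 2)))"
        by (intro mult_left_mono) auto
      moreover have "bracket (y / 2) powr ?s * ?n \<le> bracket (y / 2) powr (3/2 * ?s) * ?n"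
        using s bracket_ge_1 by (intro mult_right_mono powr_mono) auto
      moreover have "bracket y powr ?s \<le> 4 * bracket (y / 2) powr ?s"
        by (rule bracket_comparable[OF _ s]) (simp add: power_divide)
      then have "bracket y powr ?s * ?n \<le> 4 * bracket (y / 2) powr ?s * ?n"
        by (intro mult_right_mono) auto
      ultimately have "bracket y powr ?s * ?n \<le> 4 * \<bar>M0\<bar>"
        by linarith
      then show ?thesis
        using bracket_ge_1[of y] by (simp only: powr_minus) (simp add: field_simps)
    qed
    define a where "a y = Dx f (y / 2) + (u1 y + Dx u0 y)" for y
    define b where "b y = u1 y - Dx u0 y" for y
    define a' where "a' y = (1/2) *\<^sub>R Dx (Dx f) (y / 2) + (Dx u1 y + Dx (Dx u0) y)" for y
    define b' where "b' y = Dx u1 y - Dx (Dx u0) y" for y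
    have "\<exists>V Z. continuous_on half_plane V \<and> continuous_on half_plane Z \<and>
        (\<forall>t\<ge>0. \<forall>x. ((\<lambda>x. V (t, x)) has_vector_derivative Z (t, x)) (at x)) \<and>
        (\<forall>z\<in>half_plane. V z = wave_data a b z + wave_op (\<lambda>z. F (V z)) z)"
    proof (rule fixpoint[rule_format, of a a' b b' "14 * \<epsilon>"])
      show "(a has_vector_derivative a' y) (at y)" for y
      proof -
        have "((\<lambda>y. y / 2) has_vector_derivative 1/2) (at y)"
          by (auto intro!: derivative_eq_intros)
        from vector_diff_chain_at[OF this f''(1)]
        have "((\<lambda>y. Dx f (y / 2)) has_vector_derivative (1/2) *\<^sub>R Dx (Dx f) (y / 2)) (at y)"
          by (simp add: o_def)
        then show ?thesis
          unfolding a_def a'_def by (intro has_vector_derivative_add u1' u0')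
      qed
      show "(b has_vector_derivative b' y) (at y)" for y
        unfolding b_def b'_def by (intro has_vector_derivative_diff u1' u0')
      have "continuous_on UNIV (\<lambda>y::real. y / 2)"
        by (intro continuous_intros) auto
      then show "continuous_on UNIV a'"
        unfolding a'_def[abs_def]
        by (intro continuous_on_add continuous_on_scaleR continuous_on_const u0' u1'
            continuous_on_compose2[OF f''(2)]) auto
      show "continuous_on UNIV b'"
        unfolding b'_def[abs_def] by (intro continuous_on_diff u0' u1')
      have \<epsilon>14: "14 * \<epsilon> \<le> 14" "14 * \<epsilon> \<le> \<epsilon>1"
        using \<epsilon> by (auto simp: \<epsilon>0_def)
      show "14 * \<epsilon> \<le> \<epsilon>1" "0 \<le> 14 * \<epsilon>"
        using \<epsilon>14 \<epsilon> by auto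
      show "norm (b y) \<le> 14 * \<epsilon> * bracket y powr - ?s" for y
        using norm_triangle_ineq4[of "u1 y" "Dx u0 y"] u0_le[of y] u1_le[of y] unfolding b_def by linarith
      show "norm (a y) \<le> M * bracket y powr - ?s" for y
      proof -
        have "14 * \<epsilon> * bracket y powr - ?s \<le> 14 * bracket y powr - ?s"
          using \<epsilon>14 by (intro mult_right_mono) auto
        moreover have "M * bracket y powr - ?s = 4 * \<bar>M0\<bar> * bracket y powr - ?s + 14 * bracket y powr - ?s"
          by (simp add: M_def distrib_right)
        ultimately show ?thesis
          using norm_triangle_ineq[of "Dx f (y / 2)" "u1 y + Dx u0 y"] norm_triangle_ineq[of "u1 y" "Dx u0 y"]
            f_le[of y] u0_le[of y] u1_le[of y] unfolding a_def by linarith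
      qed
    qed
    then obtain V Z where V: "continuous_on half_plane V" "continuous_on half_plane Z"
      "\<And>t x. 0 \<le> t \<Longrightarrow> ((\<lambda>x. V (t, x)) has_vector_derivative Z (t, x)) (at x)"
      "\<And>z. z \<in> half_plane \<Longrightarrow> V z = wave_data a b z + wave_op (\<lambda>z. F (V z)) z"
      by blast
    have f'_cont: "continuous_on UNIV (Dx f)"
      by (rule C_k_on_continuous[OF f2])
    obtain u where u: "global_classical_solution F f u0 u1 u"
      using fixpoint_classical_solution[OF V(1,2) F_cont V(3) _ f'' u0'(1), of u1] V(4)
      unfolding a_def[abs_def] b_def[abs_def] by blast
    show "\<exists>u. global_classical_solution F f u0 u1 u \<and>
           (\<forall>w. global_classical_solution F f u0 u1 w \<longrightarrow> (\<forall>t\<ge>0. \<forall>x. w (t, x) = u (t, x)))"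
    proof (intro exI[of _ u] conjI allI impI u)
      fix w and t x :: real assume w: "global_classical_solution F f u0 u1 w" and t: "0 \<le> t"
      have "d_xi w z = d_xi u z \<and> d_eta w z = d_eta u z" if "z \<in> half_plane" for z
        using wave_fixpoint_unique[OF F_cont F_lip
            classical_solution_fixpoint(1,2)[OF w F_cont f'_cont u0'(1)]
            classical_solution_fixpoint(1,2)[OF u F_cont f'_cont u0'(1)] that]
        by (simp add: split_beta)
      then have "duhamel 0 (\<lambda>z. (1/2) *\<^sub>R (d_xi w z + d_eta w z)) (t, x) =
          duhamel 0 (\<lambda>z. (1/2) *\<^sub>R (d_xi u z + d_eta u z)) (t, x)"
        unfolding duhamel_def prod.case by (intro integral_cong) simp
      then show "w (t, x) = u (t, x)"
        using classical_solution_fixpoint(3)[OF w F_cont f'_cont u0'(1) t]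
          classical_solution_fixpoint(3)[OF u F_cont f'_cont u0'(1) t] by simp
    qed
  qed
qed

end
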